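(* Thompson's group $V$ is boundedly acyclic, i.e. $H_b^n(V;\mathbb{R})\cong 0$ for all $n\geq 1$.
   Context: Bounded cohomology with trivial real coefficients: for a (discrete) group $\Gamma$ and $n\ge 0$ let $C_b^n(\Gamma;\mathbb{R})$ be the space of bounded functions $f:\Gamma^{n+1}\to\mathbb{R}$, with $\Gamma$-action $(g\cdot f)(g_0,\dots,g_n)=f(g^{-1}g_0,\dots,g^{-1}g_n)$ and coboundary $\delta^n f(g_0,\dots,g_{n+1})=\sum_{i=0}^{n+1}(-1)^i f(g_0,\dots,\widehat{g_i},\dots,g_{n+1})$. Then $H_b^n(\Gamma;\mathbb{R})$ is the $n$-th cohomology of the complex $(C_b^\bullet(\Gamma;\mathbb{R})^\Gamma,\delta^\bullet)$ of $\Gamma$-invariants. Thompson's group $V$: let $K_{2^{\mathbb{N}}}=\{0,1\}^{\mathbb{N}}$ with the product topology, sequences being indexed by $k\ge1$. For a finite $0$-$1$-sequence (a "subroot") $r=(r_1,\dots,r_N)$ of level $N$ put $U_r=\{x\in K_{2^{\mathbb{N}}} : x_k=r_k \text{ for } 1\le k\le N\}$. Then $V\le \mathrm{Homeo}(K_{2^{\mathbb{N}}})$ consists of all maps $g:K_{2^{\mathbb{N}}}\to K_{2^{\mathbb{N}}}$ for which there are finitely many pairs of subroots $(r^1,s^1),\dots,(r^n,s^n)$ such that $K_{2^{\mathbb{N}}}=\bigcup_{i=1}^n U_{r^i}$ and $K_{2^{\mathbb{N}}}=\bigcup_{i=1}^n U_{s^i}$ are disjoint unions, and for every $i$ and $x\in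 U_{r^i}$ one has $g(x)=(s^i_1,\dots,s^i_{N_i},x_{M_i+1},x_{M_i+2},\dots)$, where $M_i$ is the level of $r^i$ and $N_i$ the level of $s^i$. *)

theory Defs
  imports "HOL-Analysis.Analysis" "HOL-Algebra.Algebra"
begin

section \<open>Bounded cohomology of a discrete group with trivial real coefficients\<close>

text \<open>
  A tuple \<open>(g\<^sub>0, \<dots>, g\<^sub>n)\<close> is a list of length \<open>n + 1\<close>. A function on the tuples is represented by
  its extensional extension, so that equality of cochains is equality of functions.
\<close>

definition tuples :: "('a, 'b) monoid_scheme \<Rightarrow> nat \<Rightarrow> 'a list set" where
  "tuples G n = {gs. length gs = Suc n \<and> set gs \<subseteq> carrier G}"

definition bounded_cochains :: "('a, 'b) monoid_scheme \<Rightarrow> nat \<Rightarrow> ('a list \<Rightarrow> real) set" where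
  "bounded_cochains G n = {f \<in> extensional (tuples G n). bounded (f ` tuples G n)}"

definition cochain_act ::
    "('a, 'b) monoid_scheme \<Rightarrow> nat \<Rightarrow> 'a \<Rightarrow> ('a list \<Rightarrow> real) \<Rightarrow> 'a list \<Rightarrow> real" where
  "cochain_act G n g f = (\<lambda>gs\<in>tuples G n. f (map (\<lambda>h. inv\<^bsub>G\<^esub> g \<otimes>\<^bsub>G\<^esub> h) gs))"

definition invariant_bounded_cochains ::
    "('a, 'b) monoid_scheme \<Rightarrow> nat \<Rightarrow> ('a list \<Rightarrow> real) set" where
  "invariant_bounded_cochains G n =
     {f \<in> bounded_cochains G n. \<forall>g\<in>carrier G. cochain_act G n g f = f}"

definition omit :: "nat \<Rightarrow> 'a list \<Rightarrow> 'a list" where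
  "omit i gs = take i gs @ drop (Suc i) gs"

definition coboundary ::
    "('a, 'b) monoid_scheme \<Rightarrow> nat \<Rightarrow> ('a list \<Rightarrow> real) \<Rightarrow> 'a list \<Rightarrow> real" where
  "coboundary G n f = (\<lambda>gs\<in>tuples G (Suc n). \<Sum>i\<le>Suc n. (-1) ^ i * f (omit i gs))"

definition cochain_group ::
    "('a, 'b) monoid_scheme \<Rightarrow> nat \<Rightarrow> ('a list \<Rightarrow> real) monoid" where
  "cochain_group G n =
     \<lparr>carrier = invariant_bounded_cochains G n,
      mult = (\<lambda>f h. \<lambda>gs\<in>tuples G n. f gs + h gs),
      one = (\<lambda>gs\<in>tuples G n. 0)\<rparr>"

definition bounded_cocycles ::
    "('a, 'b) monoid_scheme \<Rightarrow> nat \<Rightarrow> ('a list \<Rightarrow> real) set" where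
  "bounded_cocycles G n =
     kernel (cochain_group G n) (cochain_group G (Suc n)) (coboundary G n)"

text \<open>In degree \<open>0\<close> the incoming differential of the complex is the zero map.\<close>

fun bounded_coboundaries ::
    "('a, 'b) monoid_scheme \<Rightarrow> nat \<Rightarrow> ('a list \<Rightarrow> real) set" where
  "bounded_coboundaries G 0 = {\<one>\<^bsub>cochain_group G 0\<^esub>}"
| "bounded_coboundaries G (Suc n) = coboundary G n ` carrier (cochain_group G n)"

definition bounded_cohomology ::
    "('a, 'b) monoid_scheme \<Rightarrow> nat \<Rightarrow> ('a list \<Rightarrow> real) set monoid" where
  "bounded_cohomology G n =
     (cochain_group G n\<lparr>carrier := bounded_cocycles G n\<rparr>) Mod bounded_coboundaries G n"

definition boundedly_acyclic :: "('a, 'b) monoid_scheme \<Rightarrow> bool" where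
  "boundedly_acyclic G \<longleftrightarrow> (\<forall>n\<ge>1. trivial_group (bounded_cohomology G n))"


section \<open>Thompson's group V\<close>

definition Homeo :: "('a::topological_space \<Rightarrow> 'a) monoid" where
  "Homeo = \<lparr>carrier = {g. \<exists>g'. homeomorphism UNIV UNIV g g'}, mult = (\<circ>), one = id\<rparr>"

text \<open>
  The Cantor space is the type \<^typ>\<open>nat \<Rightarrow> bool\<close>, whose class instance of
  \<^class>\<open>topological_space\<close> is the product of the discrete topologies. Sequences are indexed
  from \<open>0\<close> instead of \<open>1\<close>.
\<close>

definition cylinder :: "bool list \<Rightarrow> (nat \<Rightarrow> bool) set" where
  "cylinder r = {x. \<forall>k<length r. x k = r ! k}"

definition replace_prefix :: "bool list \<Rightarrow> bool list \<Rightarrow> (nat \<Rightarrow> bool) \<Rightarrow> nat \<Rightarrow> bool" where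
  "replace_prefix r s x =
     (\<lambda>k. if k < length s then s ! k else x (length r + (k - length s)))"

definition prefix_exchange :: "((nat \<Rightarrow> bool) \<Rightarrow> nat \<Rightarrow> bool) \<Rightarrow> bool" where
  "prefix_exchange g \<longleftrightarrow>
     (\<exists>(n::nat) (r :: nat \<Rightarrow> bool list) (s :: nat \<Rightarrow> bool list).
        disjoint_family_on (\<lambda>i. cylinder (r i)) {..<n} \<and> (\<Union>i<n. cylinder (r i)) = UNIV \<and>
        disjoint_family_on (\<lambda>i. cylinder (s i)) {..<n} \<and> (\<Union>i<n. cylinder (s i)) = UNIV \<and>
        (\<forall>i<n. \<forall>x\<in>cylinder (r i). g x = replace_prefix (r i) (s i) x))"

definition thompson_V :: "((nat \<Rightarrow> bool) \<Rightarrow> nat \<Rightarrow> bool) monoid" where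
  "thompson_V = Homeo\<lparr>carrier := {g \<in> carrier Homeo. prefix_exchange g}\<rparr>"

end

theory Submission
  imports Defs
begin

text \<open>
  Call a group \<open>K\<close> of permutations displaceable if the wreath product of any finite part \<open>S\<close> of \<open>K\<close>
  with any finite symmetric group maps to \<open>K\<close>, the first copy of \<open>S\<close> being \<open>S\<close> itself. Replacing
  \<open>g\<^sub>j\<close> by \<open>g\<^sub>j z\<^sub>j\<close> for a suitable random tuple \<open>z\<close> of products of commuting conjugates changes a
  bounded cocycle by a coboundary, and makes it almost constant on \<open>S\<^bsup>n+1\<^esup>\<close>. Hence bounded cocycles of
  positive degree on \<open>K\<close> are coboundaries, by passing to an ultralimit.

  The group \<open>V\<close> acts on the tail equivalence class \<open>Y\<close> of a sequence that is not eventually periodic.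
  It is transitive on tuples of distinct points, and an element that fixes a point of \<open>Y\<close> is the
  identity near it, so the stabilizer of a nonempty tuple is displaceable: it moves the complement of
  small neighbourhoods of the points into arbitrarily many disjoint copies of itself. In the double
  complex of bounded \<open>V\<close>-invariant functions of group elements and of distinct points of \<open>Y\<close>, the
  columns are therefore exact in positive degree with constants in degree \<open>0\<close>, while the rows are
  exact because a further point can always be inserted. A diagram chase gives the claim.
\<close>

section \<open>Coboundaries and the prism homotopy\<close>

text \<open>Displaceability cannot be applied to V itself: V has a finite generating set, and a
  conjugate commuting with it would be central, hence trivial. Room for commuting copies appears
  only after a point is fixed, which is why V has to act on something.

  The points must be chosen with care. At an eventually periodic point a prefix replacement can fix
  the point and contract its neighbourhood, so some elements of the stabilizer have support reaching
  the point, and no complement of a neighbourhood contains that support.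

  In the averaging, the role of an invariant mean is played by the multiplicities with which tuples
  of S occupy the blocks: they range over a large box, and one more copy is one step in that box.
  All bounds obtained are independent of S and of the size of the box, so the ultralimit stays
  bounded.

  Both the averaging and the lowest step of the chase give primitives only up to an additive
  constant. Such a constant is itself a coboundary or vanishes, according to parity.\<close>

text \<open>The length is left open, so one operator serves group elements and points in every
  degree. On a one-element list it returns \<open>f []\<close>, the augmentation, which ends the
  argument in \<open>cocycle_exact\<close>.\<close>

definition cob :: "('a list \<Rightarrow> real) \<Rightarrow> 'a list \<Rightarrow> real" where
  "cob f xs = (\<Sum>i<length xs. (-1) ^ i * f (omit i xs))"

lemma length_omit: "i < length xs \<Longrightarrow> length (omit i xs) = length xs - 1"
  by (simp add: omit_def)

lemma set_omit_subset: "set (omit i xs) \<subseteq> set xs"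
  by (auto simp: omit_def dest: in_set_takeD in_set_dropD)

lemma distinct_omit: "distinct xs \<Longrightarrow> distinct (omit i xs)"
  by (auto simp: omit_def set_take_disj_set_drop_if_distinct)

lemma map_omit: "map h (omit i xs) = omit i (map h xs)"
  by (simp add: omit_def take_map drop_map)

lemma omit_0_Cons [simp]: "omit 0 (x # xs) = xs"
  by (simp add: omit_def)

lemma omit_Suc_Cons [simp]: "omit (Suc i) (x # xs) = x # omit i xs"
  by (simp add: omit_def)

lemma cob_Nil [simp]: "cob f [] = 0"
  by (simp add: cob_def)

text \<open>Splitting off the first entry turns the alternating signs into a single minus sign, so
  that identities can be proved by induction on lists without index bookkeeping.\<close>

lemma cob_Cons: "cob f (x # xs) = f xs - cob (\<lambda>ys. f (x # ys)) xs"
  by (simp add: cob_def sum.lessThan_Suc_shift sum_negf del: sum.lessThan_Suc)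

lemma cob_cong:
  "(\<And>i. i < length xs \<Longrightarrow> f (omit i xs) = g (omit i xs)) \<Longrightarrow> cob f xs = cob g xs"
  by (simp add: cob_def)

lemma cob_diff: "cob (\<lambda>ys. f ys - g ys) xs = cob f xs - cob g xs"
  by (simp add: cob_def right_diff_distrib sum_subtractf)

lemma cob_add: "cob (\<lambda>ys. f ys + g ys) xs = cob f xs + cob g xs"
  by (simp add: cob_def distrib_left sum.distrib)

lemma cob_divide: "cob (\<lambda>ys. f ys / c) xs = cob f xs / c"
  by (simp add: cob_def sum_divide_distrib)

lemma cob_sum: "cob (\<lambda>ys. \<Sum>i\<in>I. f i ys) xs = (\<Sum>i\<in>I. cob (f i) xs)"
  by (induction I rule: infinite_finite_induct) (auto simp: cob_add, auto simp: cob_def)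

text \<open>The parity found here decides later whether a stray constant can be absorbed or has to
  vanish.\<close>

lemma cob_const: "cob (\<lambda>_. c) xs = (if odd (length xs) then c else 0)"
  by (induction xs) (auto simp: cob_Cons)

lemma cob_map: "cob (\<lambda>ys. f (map h ys)) xs = cob f (map h xs)"
  by (simp add: cob_def map_omit)

lemma cob_cob: "cob (cob f) xs = 0"
proof (induction xs arbitrary: f)
  case (Cons x xs)
  then show ?case
    by (simp add: cob_Cons[of "cob f"] cob_Cons[of f] cob_diff)
qed simp

text \<open>The two directions of the double complex are sums over independent index sets, so they
  commute without a sign, and corrections in the chase carry no sign convention.\<close>

lemma cob_commute: "cob (\<lambda>xs. cob (\<lambda>ys. F xs ys) ys) xs = cob (\<lambda>ys. cob (\<lambda>xs. F xs ys) xs) ys"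
  unfolding cob_def sum_distrib_left by (subst sum.swap) (simp add: mult.left_commute)

lemma abs_cob_le:
  fixes B :: real
  assumes "\<And>i. i < length xs \<Longrightarrow> \<bar>f (omit i xs)\<bar> \<le> B"
  shows "\<bar>cob f xs\<bar> \<le> length xs * B"
proof -
  have "\<bar>cob f xs\<bar> \<le> (\<Sum>i<length xs. \<bar>(-1) ^ i * f (omit i xs)\<bar>)"
    unfolding cob_def by (rule sum_abs)
  also have "\<dots> \<le> (\<Sum>i<length xs. B)"
    by (intro sum_mono) (simp add: assms abs_mult power_abs)
  finally show ?thesis by simp
qed

text \<open>Unfolded, this is the sum over i of (-1)^i f(x_0, ..., x_i, y_i, ..., y_n), the usual
  decomposition of the prism with bottom x and top y.\<close>

fun prism :: "('a list \<Rightarrow> real) \<Rightarrow> ('a \<times> 'a) list \<Rightarrow> real" where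
  "prism f [] = 0"
| "prism f ((x, y) # ps) = f (x # y # map snd ps) - prism (\<lambda>zs. f (x # zs)) ps"

lemma prism_diff: "prism (\<lambda>zs. f zs - g zs) ps = prism f ps - prism g ps"
  by (induction ps arbitrary: f g) auto

text \<open>The outer \<open>cob\<close> runs over lists of pairs, so a face deletes x_i and y_i
  together. For a cocycle the term \<open>prism (cob f)\<close> drops out, and replacing the bottom
  by the top costs only a coboundary.\<close>

lemma prism_homotopy: "cob (prism f) ps + prism (cob f) ps = f (map snd ps) - f (map fst ps)"
proof (induction ps arbitrary: f)
  case (Cons p ps)
  obtain x y where p: "p = (x, y)" by fastforce
  show ?case
    using Cons.IH[of "\<lambda>zs. f (x # zs)"]
    by (simp add: p cob_Cons prism_diff cob_diff cob_map[of "\<lambda>zs. f (x # y # zs)"])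
qed simp

lemma prism_cong:
  assumes "\<And>zs. length zs = Suc (length ps) \<Longrightarrow> set zs \<subseteq> set (map fst ps) \<union> set (map snd ps)
             \<Longrightarrow> f zs = g zs"
  shows "prism f ps = prism g ps"
  using assms
proof (induction ps arbitrary: f g)
  case (Cons p ps)
  obtain x y where p: "p = (x, y)" by fastforce
  have "prism (\<lambda>zs. f (x # zs)) ps = prism (\<lambda>zs. g (x # zs)) ps"
    by (rule Cons.IH, rule Cons.prems) (auto simp: p)
  moreover have "f (x # y # map snd ps) = g (x # y # map snd ps)"
    by (rule Cons.prems) (auto simp: p)
  ultimately show ?case by (simp add: p)
qed simp

lemma abs_prism_le:
  fixes B :: real
  assumes "\<And>zs. length zs = Suc (length ps) \<Longrightarrow> set zs \<subseteq> set (map fst ps) \<union> set (map snd ps)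
             \<Longrightarrow> \<bar>f zs\<bar> \<le> B"
  shows "\<bar>prism f ps\<bar> \<le> length ps * B"
  using assms
proof (induction ps arbitrary: f)
  case (Cons p ps)
  obtain x y where p: "p = (x, y)" by fastforce
  have "\<bar>prism (\<lambda>zs. f (x # zs)) ps\<bar> \<le> length ps * B"
    by (rule Cons.IH, rule Cons.prems) (auto simp: p)
  moreover have "\<bar>f (x # y # map snd ps)\<bar> \<le> B"
    by (rule Cons.prems) (auto simp: p)
  ultimately show ?case by (simp add: p algebra_simps)
qed simp

lemma prism_map: "prism (\<lambda>zs. f (map h zs)) ps = prism f (map (map_prod h h) ps)"
proof (induction ps arbitrary: f)
  case (Cons p ps)
  obtain x y where p: "p = (x, y)" by fastforce
  show ?case
    using Cons.IH[of "\<lambda>zs. f (h x # zs)"] by (simp add: p comp_def)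
qed simp

section \<open>Ultralimits\<close>

definition ultra :: "'a filter \<Rightarrow> bool" where
  "ultra U \<longleftrightarrow> U \<noteq> bot \<and> (\<forall>P. eventually P U \<or> eventually (\<lambda>x. \<not> P x) U)"

text \<open>Zorn's lemma with finer filters counted as larger. The infimum of a chain of proper
  filters is proper, because whatever holds eventually for it already holds eventually for a member
  of the chain.\<close>

lemma exists_ultra_le:
  fixes F :: "'a filter"
  assumes "F \<noteq> bot"
  shows "\<exists>U\<le>F. ultra U"
proof -
  let ?A = "{G. G \<noteq> bot \<and> G \<le> F}"
  have "\<exists>U\<in>?A. \<forall>G\<in>?A. G \<le> U \<longrightarrow> G = U"
  proof (rule predicate_Zorn[of ?A "\<lambda>G H. H \<le> G"])
    show "partial_order_on ?A (relation_of (\<lambda>G H. H \<le> G) ?A)"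
      by (rule partial_order_on_relation_ofI) auto
    fix C assume C: "C \<in> Chains (relation_of (\<lambda>G H. H \<le> G) ?A)"
    then have sub: "C \<subseteq> ?A" and tot: "\<And>G H. G \<in> C \<Longrightarrow> H \<in> C \<Longrightarrow> G \<le> H \<or> H \<le> G"
      by (auto simp: Chains_def relation_of_def)
    show "\<exists>u\<in>?A. \<forall>G\<in>C. u \<le> G"
    proof (cases "C = {}")
      case False
      have ev: "eventually P (Inf C) \<longleftrightarrow> (\<exists>G\<in>C. eventually P G)" for P
      proof (rule eventually_Inf_base[OF False])
        fix G H assume "G \<in> C" "H \<in> C"
        then show "\<exists>x\<in>C. x \<le> inf G H"
          using tot[of G H] by (auto simp: inf.absorb1 inf.absorb2)
      qed
      have "Inf C \<noteq> bot"
        unfolding trivial_limit_def ev using sub by (auto simp: trivial_limit_def)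
      moreover have "Inf C \<le> F"
      proof -
        obtain G where "G \<in> C" using False by blast
        with sub have "G \<le> F" by blast
        with Inf_lower[OF \<open>G \<in> C\<close>] show ?thesis by (rule order_trans)
      qed
      moreover have "\<forall>G\<in>C. Inf C \<le> G" by (simp add: Inf_lower)
      ultimately show ?thesis by blast
    qed (use assms in auto)
  qed
  then obtain U where U: "U \<noteq> bot" "U \<le> F" and "\<forall>G\<in>?A. G \<le> U \<longrightarrow> G = U"
    by blast
  then have max: "\<And>G. G \<noteq> bot \<Longrightarrow> G \<le> U \<Longrightarrow> G = U"
    using order_trans by blast
  \<comment> \<open>The trace of U on P refines U; if it is proper, maximality makes it equal to U,
    and otherwise U decides against P.\<close>
  have "eventually P U \<or> eventually (\<lambda>x. \<not> P x) U" for P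
  proof (cases "inf U (principal {x. P x}) = bot")
    case True
    then show ?thesis
      by (simp add: trivial_limit_def eventually_inf_principal)
  next
    case False
    then have "inf U (principal {x. P x}) = U" by (intro max) auto
    moreover have "eventually P (inf U (principal {x. P x}))"
      by (simp add: eventually_inf_principal)
    ultimately show ?thesis by simp
  qed
  with U show ?thesis unfolding ultra_def by blast
qed

text \<open>Compactness of the interval gives a cluster point of the image filter. An ultrafilter
  decides every neighbourhood of it, so clustering is already convergence.\<close>

lemma ultra_convergent:
  fixes f :: "'a \<Rightarrow> real"
  assumes U: "ultra U" and B: "eventually (\<lambda>x. \<bar>f x\<bar> \<le> B) U"
  shows "\<exists>l. (f \<longlongrightarrow> l) U"
proof -
  have nb: "filtermap f U \<noteq> bot" using U by (simp add: ultra_def filtermap_bot_iff)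
  have "eventually (\<lambda>y. y \<in> {-B..B}) (filtermap f U)"
    using B by (simp add: eventually_filtermap abs_le_iff) (auto elim: eventually_mono)
  then obtain l where l: "inf (nhds l) (filtermap f U) \<noteq> bot"
    using compact_filter[of "{-B..B}"] nb by (metis compact_Icc)
  have "(f \<longlongrightarrow> l) U"
    unfolding tendsto_def
  proof (intro allI impI)
    fix S assume S: "open S" "l \<in> S"
    show "eventually (\<lambda>x. f x \<in> S) U"
    proof (rule ccontr)
      assume "\<not> eventually (\<lambda>x. f x \<in> S) U"
      then have "eventually (\<lambda>x. f x \<notin> S) U" using U by (auto simp: ultra_def)
      then have "eventually (\<lambda>y. y \<notin> S) (filtermap f U)" by (simp add: eventually_filtermap)
      moreover have "eventually (\<lambda>y. y \<in> S) (nhds l)" using S by (rule eventually_nhds_in_open)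
      ultimately have "eventually (\<lambda>y. False) (inf (nhds l) (filtermap f U))"
        unfolding eventually_inf by blast
      with l show False by (simp add: trivial_limit_def)
    qed
  qed
  then show ?thesis ..
qed

lemma ultra_tendsto_Lim:
  fixes f :: "'a \<Rightarrow> real"
  assumes "ultra U" "eventually (\<lambda>x. \<bar>f x\<bar> \<le> B) U"
  shows "(f \<longlongrightarrow> Lim U f) U"
  using ultra_convergent[OF assms] assms(1) by (auto simp: ultra_def tendsto_Lim)

lemma abs_Lim_le:
  fixes f :: "'a \<Rightarrow> real"
  assumes "ultra U" "eventually (\<lambda>x. \<bar>f x\<bar> \<le> B) U"
  shows "\<bar>Lim U f\<bar> \<le> B"
  using tendsto_upperbound[OF tendsto_rabs[OF ultra_tendsto_Lim[OF assms]] assms(2)] assms(1)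
  by (simp add: ultra_def)

lemma tendsto_cob:
  assumes "\<And>i. i < length xs \<Longrightarrow> ((\<lambda>k. f k (omit i xs)) \<longlongrightarrow> l (omit i xs)) U"
  shows "((\<lambda>k. cob (f k) xs) \<longlongrightarrow> cob l xs) U"
  unfolding cob_def by (intro tendsto_intros) (simp add: assms)

section \<open>Displaceable groups\<close>

text \<open>HOL-Algebra reserves the prefix \<open>inv\<close> for inverses in a group.\<close>

abbreviation finv :: "('a \<Rightarrow> 'b) \<Rightarrow> 'b \<Rightarrow> 'a" where
  "finv \<equiv> inv_into UNIV"

text \<open>The index is the length, hence one more than the cochain degree that indexes
  \<open>tuples\<close>.\<close>

definition tup :: "nat \<Rightarrow> 'a set \<Rightarrow> 'a list set" where
  "tup n S = {xs. length xs = n \<and> set xs \<subseteq> S}"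

lemma tupI: "length xs = n \<Longrightarrow> set xs \<subseteq> S \<Longrightarrow> xs \<in> tup n S"
  by (simp add: tup_def)

lemma nth_tup: "xs \<in> tup n S \<Longrightarrow> i < n \<Longrightarrow> xs ! i \<in> S"
  by (auto simp: tup_def)

lemma omit_tup: "xs \<in> tup (Suc n) S \<Longrightarrow> i < Suc n \<Longrightarrow> omit i xs \<in> tup n S"
  using set_omit_subset[of i xs] by (auto simp: tup_def length_omit)

lemma finite_tup: "finite S \<Longrightarrow> finite (tup n S)"
  using finite_lists_length_eq[of S n] by (simp add: tup_def conj_commute)

lemma nth_omit:
  "i < length xs - 1 \<Longrightarrow> omit k xs ! i = (if i < k then xs ! i else xs ! Suc i)"
  by (auto simp: omit_def nth_append min_def)

lemma omit_zip:
  "length xs = length ys \<Longrightarrow> omit k (zip xs ys) = zip (omit k xs) (omit k ys)"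
  by (simp add: omit_def take_zip drop_zip zip_append)

text \<open>Averaging over all permutations of the coordinates makes the law of a random tuple
  exchangeable, so that its faces all have the same law.\<close>

lemma sum_permutes_omit:
  fixes F :: "'b list \<Rightarrow> real"
  assumes "k \<le> n"
  shows "(\<Sum>\<pi> | \<pi> permutes {..n}. F (omit k (map (\<lambda>j. z (\<pi> j)) [0..<Suc n]))) =
         (\<Sum>\<pi> | \<pi> permutes {..n}. F (map (\<lambda>j. z (\<pi> j)) [0..<n]))"
proof -
  \<comment> \<open>\<open>\<kappa>\<close> lists 0, ..., n with k moved to the end, so precomposing
    with it turns omission of entry k into omission of the last entry.\<close>
  define \<kappa> where "\<kappa> j = (if j < k then j else if j < n then Suc j else if j = n then k else j)" for j
  have inj: "inj_on \<kappa> {..n}"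
    using assms by (auto simp: inj_on_def \<kappa>_def split: if_splits)
  moreover have "\<kappa> ` {..n} \<subseteq> {..n}" using assms by (auto simp: \<kappa>_def)
  ultimately have "bij_betw \<kappa> {..n} {..n}"
    by (simp add: bij_betw_def endo_inj_surj)
  then have \<kappa>: "\<kappa> permutes {..n}"
    by (rule bij_imp_permutes) (use assms in \<open>auto simp: \<kappa>_def\<close>)
  have "omit k (map (\<lambda>j. z (\<pi> j)) [0..<Suc n]) = map (\<lambda>j. z ((\<pi> \<circ> \<kappa>) j)) [0..<n]" for \<pi>
    using assms by (intro nth_equalityI) (auto simp: length_omit nth_omit \<kappa>_def simp del: upt_Suc)
  then show ?thesis
    using sum_permutations_compose_right[OF \<kappa>, of "\<lambda>\<pi>. F (map (\<lambda>j. z (\<pi> j)) [0..<n])"] by (simp del: upt_Suc)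
qed

section \<open>Invariant bounded cochains of a permutation group\<close>

text \<open>K acts while the entries come from G: such cochains arise by evaluating a G-equivariant
  cochain of the double complex at one tuple of points with stabilizer K.\<close>

definition inv_cochain ::
    "('a \<Rightarrow> 'a) set \<Rightarrow> ('a \<Rightarrow> 'a) set \<Rightarrow> nat \<Rightarrow> (('a \<Rightarrow> 'a) list \<Rightarrow> real) \<Rightarrow> bool" where
  "inv_cochain K G n f \<longleftrightarrow>
     (\<forall>k\<in>K. \<forall>gs\<in>tup n G. f (map ((\<circ>) k) gs) = f gs) \<and> (\<exists>B. \<forall>gs\<in>tup n G. \<bar>f gs\<bar> \<le> B)"

locale perm_group =
  fixes G :: "('a \<Rightarrow> 'a) set"
  assumes id_mem: "id \<in> G"
    and comp_mem: "g \<in> G \<Longrightarrow> h \<in> G \<Longrightarrow> g \<circ> h \<in> G"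
    and bij_mem: "g \<in> G \<Longrightarrow> bij g"
    and inv_mem: "g \<in> G \<Longrightarrow> finv g \<in> G"
begin

lemma comp_inv: "g \<in> G \<Longrightarrow> g \<circ> finv g = id" "g \<in> G \<Longrightarrow> finv g \<circ> g = id"
  using bij_mem by (auto simp: bij_is_surj surj_iff[symmetric] bij_is_inj)

lemma map_comp_tup: "k \<in> G \<Longrightarrow> gs \<in> tup n G \<Longrightarrow> map ((\<circ>) k) gs \<in> tup n G"
  using comp_mem by (auto simp: tup_def)

end

lemma inv_cochain_cong:
  assumes "perm_group G" "K \<subseteq> G" "\<And>gs. gs \<in> tup n G \<Longrightarrow> f gs = f' gs"
  shows "inv_cochain K G n f \<longleftrightarrow> inv_cochain K G n f'"
  using perm_group.map_comp_tup[OF assms(1)] assms(2,3) unfolding inv_cochain_def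
  by (auto simp: subset_iff)

lemma inv_cochain_add:
  assumes "inv_cochain K G n f" "inv_cochain K G n f'"
  shows "inv_cochain K G n (\<lambda>gs. f gs + f' gs)"
proof -
  obtain B B' where "\<forall>gs\<in>tup n G. \<bar>f gs\<bar> \<le> B" "\<forall>gs\<in>tup n G. \<bar>f' gs\<bar> \<le> B'"
    using assms by (auto simp: inv_cochain_def)
  then have "\<forall>gs\<in>tup n G. \<bar>f gs + f' gs\<bar> \<le> B + B'" by fastforce
  then show ?thesis using assms by (auto simp: inv_cochain_def)
qed

lemma inv_cochain_cob:
  assumes "inv_cochain G G n f"
  shows "inv_cochain G G (Suc n) (cob f)"
proof -
  obtain B where B: "\<forall>gs\<in>tup n G. \<bar>f gs\<bar> \<le> B" using assms by (auto simp: inv_cochain_def)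
  have "\<bar>cob f gs\<bar> \<le> Suc n * B" if "gs \<in> tup (Suc n) G" for gs
  proof -
    have "length gs = Suc n" using that by (simp add: tup_def)
    then show ?thesis using abs_cob_le[of gs f B] B omit_tup[OF that] by simp
  qed
  moreover have "cob f (map ((\<circ>) g) gs) = cob f gs" if "g \<in> G" "gs \<in> tup (Suc n) G" for g gs
  proof -
    have "length gs = Suc n" using that by (simp add: tup_def)
    then show ?thesis
      using assms omit_tup[OF that(2)] that(1) unfolding cob_map[of f, symmetric]
      by (intro cob_cong) (simp add: inv_cochain_def)
  qed
  ultimately show ?thesis unfolding inv_cochain_def by blast
qed

section \<open>Transport into a subgroup by an averaged homotopy\<close>

text \<open>K acts freely on G by left multiplication: choose a representative h in each coset K g
  and let p g be \<open>g \<circ> finv h\<close>. Equivariance of p later makes the primitives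
  K-invariant.\<close>

lemma exists_equivariant_projection:
  fixes G K :: "('a \<Rightarrow> 'a) set"
  assumes "perm_group G" "perm_group K" "K \<subseteq> G"
  shows "\<exists>p :: ('a \<Rightarrow> 'a) \<Rightarrow> 'a \<Rightarrow> 'a. (\<forall>g\<in>G. p g \<in> K) \<and> (\<forall>k\<in>K. \<forall>g. p (k \<circ> g) = k \<circ> p g)"
proof -
  interpret G: perm_group G by fact
  interpret K: perm_group K by fact
  define C where "C g = {k \<circ> g |k. k \<in> K}" for g :: "'a \<Rightarrow> 'a"
  define p where "p g = g \<circ> finv (SOME h. h \<in> C g)" for g :: "'a \<Rightarrow> 'a"
  have C: "C (k \<circ> g) = C g" if "k \<in> K" for k g
  proof
    show "C (k \<circ> g) \<subseteq> C g" using K.comp_mem that by (auto simp: C_def) (metis comp_assoc)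
    show "C g \<subseteq> C (k \<circ> g)"
    proof
      fix x assume "x \<in> C g"
      then obtain l where l: "l \<in> K" "x = l \<circ> g" by (auto simp: C_def)
      have "x = (l \<circ> finv k) \<circ> (k \<circ> g)"
        using K.comp_inv(2)[OF that] l by (metis comp_assoc comp_id)
      then show "x \<in> C (k \<circ> g)"
        using K.comp_mem K.inv_mem that l unfolding C_def by blast
    qed
  qed
  have "p g \<in> K" if "g \<in> G" for g
  proof -
    have "g \<in> C g" using K.id_mem unfolding C_def by (metis (mono_tags, lifting) id_comp mem_Collect_eq)
    then have "(SOME h. h \<in> C g) \<in> C g" by (rule someI[where P = "\<lambda>h. h \<in> C g"])
    then obtain k where k: "k \<in> K" "(SOME h. h \<in> C g) = k \<circ> g" by (auto simp: C_def)
    then have "p g = g \<circ> (finv g \<circ> finv k)"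
      unfolding p_def using G.bij_mem[OF that] K.bij_mem by (simp add: o_inv_distrib)
    also have "\<dots> = finv k" using G.comp_inv(1)[OF that] by (metis comp_assoc id_comp)
    finally show ?thesis using K.inv_mem k by simp
  qed
  moreover have "p (k \<circ> g) = k \<circ> p g" if "k \<in> K" for k g
    unfolding p_def C[OF that] by (simp add: comp_assoc)
  ultimately show ?thesis by blast
qed

text \<open>The obstacle is that a face of gs has n entries while z has n + 1. Each n-tuple is
  paired with the first n permuted entries of z; after averaging over all \<pi> these have the same
  law as the entries that remain when the matching one is deleted, so the faces fit
  together.\<close>

lemma averaged_homotopy:
  fixes f :: "('a \<Rightarrow> 'a) list \<Rightarrow> real"
  assumes G: "perm_group G" and KG: "K \<subseteq> G"
    and p: "\<forall>g\<in>G. p g \<in> K"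
    and f: "\<forall>gs\<in>tup (Suc (Suc n)) G. cob f gs = 0"
    and \<Omega>: "finite \<Omega>" "\<Omega> \<noteq> {}"
    and z: "\<forall>\<omega>\<in>\<Omega>. \<forall>j\<le>n. z \<omega> j \<in> K"
    and gs: "gs \<in> tup (Suc n) G"
  defines "N \<equiv> real (card \<Omega>) * fact (Suc n)"
  shows "cob (\<lambda>gs. (\<Sum>\<omega>\<in>\<Omega>. \<Sum>\<pi> | \<pi> permutes {..n}.
             prism f (map2 (\<lambda>g k. (g, p g \<circ> k)) gs (map (\<lambda>j. z \<omega> (\<pi> j)) [0..<n]))) / N) gs
       = (\<Sum>\<omega>\<in>\<Omega>. \<Sum>\<pi> | \<pi> permutes {..n}.
             f (map2 (\<circ>) (map p gs) (map (\<lambda>j. z \<omega> (\<pi> j)) [0..<Suc n]))) / N - f gs"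
proof -
  interpret G: perm_group G by fact
  define q where "q gs ks = map2 (\<lambda>g k. (g, p g \<circ> k)) gs ks" for gs ks :: "('a \<Rightarrow> 'a) list"
  define zs where "zs \<omega> \<pi> = map (\<lambda>j. z \<omega> (\<pi> j)) [0..<Suc n]" for \<omega> \<pi>
  let ?P = "{\<pi>. \<pi> permutes {..n}}"
  have len: "length gs = Suc n" using gs by (simp add: tup_def)
  have N: "N > 0" using \<Omega> by (simp add: N_def card_gt_0_iff)
  have step: "cob (\<lambda>gs. \<Sum>\<pi>\<in>?P. prism f (q gs (map (\<lambda>j. z \<omega> (\<pi> j)) [0..<n]))) gs
      = (\<Sum>\<pi>\<in>?P. f (map2 (\<circ>) (map p gs) (zs \<omega> \<pi>)) - f gs)" if \<omega>: "\<omega> \<in> \<Omega>" for \<omega>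
  proof -
    have "cob (\<lambda>gs. \<Sum>\<pi>\<in>?P. prism f (q gs (map (\<lambda>j. z \<omega> (\<pi> j)) [0..<n]))) gs
        = (\<Sum>i<Suc n. (-1) ^ i * (\<Sum>\<pi>\<in>?P. prism f (q (omit i gs) (map (\<lambda>j. z \<omega> (\<pi> j)) [0..<n]))))"
      by (simp add: cob_def len)
    also have "\<dots> = (\<Sum>i<Suc n. (-1) ^ i * (\<Sum>\<pi>\<in>?P. prism f (q (omit i gs) (omit i (zs \<omega> \<pi>)))))"
      unfolding zs_def
      by (intro sum.cong refl arg_cong2[where f = "(*)"] sum_permutes_omit[symmetric]) auto
    also have "\<dots> = (\<Sum>i<Suc n. (-1) ^ i * (\<Sum>\<pi>\<in>?P. prism f (omit i (q gs (zs \<omega> \<pi>)))))"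
    proof -
      have "q (omit i gs) (omit i (zs \<omega> \<pi>)) = omit i (q gs (zs \<omega> \<pi>))" for i \<pi>
        unfolding q_def zs_def by (subst omit_zip[symmetric]) (auto simp: len map_omit)
      then show ?thesis by simp
    qed
    also have "\<dots> = (\<Sum>\<pi>\<in>?P. cob (prism f) (q gs (zs \<omega> \<pi>)))"
      unfolding cob_def sum_distrib_left
      by (subst sum.swap) (simp add: q_def zs_def len)
    also have "\<dots> = (\<Sum>\<pi>\<in>?P. f (map2 (\<circ>) (map p gs) (zs \<omega> \<pi>)) - f gs)"
    proof (rule sum.cong[OF refl])
      fix \<pi> assume "\<pi> \<in> ?P"
      then have \<pi>: "\<pi> j \<le> n" if "j \<le> n" for j
        using that permutes_in_image[of \<pi> "{..n}" j] by simp
      have K: "set (zs \<omega> \<pi>) \<subseteq> K"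
        using z \<omega> \<pi> by (auto simp: zs_def simp del: upt_Suc)
      have fst: "map fst (q gs (zs \<omega> \<pi>)) = gs"
        by (rule nth_equalityI) (auto simp: q_def zs_def len simp del: upt_Suc)
      have snd: "map snd (q gs (zs \<omega> \<pi>)) = map2 (\<circ>) (map p gs) (zs \<omega> \<pi>)"
        by (rule nth_equalityI) (auto simp: q_def zs_def len simp del: upt_Suc)
      have sub: "set (map snd (q gs (zs \<omega> \<pi>))) \<subseteq> G"
      proof
        fix x assume "x \<in> set (map snd (q gs (zs \<omega> \<pi>)))"
        then obtain g k where "g \<in> set gs" "k \<in> set (zs \<omega> \<pi>)" "x = p g \<circ> k"
          by (auto simp: q_def dest: set_zip_leftD set_zip_rightD)
        then show "x \<in> G" using K KG p gs by (auto simp: tup_def intro!: G.comp_mem)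
      qed
      \<comment> \<open>All vertices of the prism lie in G, where f is a cocycle, so this term of
        the homotopy vanishes.\<close>
      have "prism (cob f) (q gs (zs \<omega> \<pi>)) = prism (\<lambda>_. 0) (q gs (zs \<omega> \<pi>))"
      proof (rule prism_cong)
        fix ks assume "length ks = Suc (length (q gs (zs \<omega> \<pi>)))"
          "set ks \<subseteq> set (map fst (q gs (zs \<omega> \<pi>))) \<union> set (map snd (q gs (zs \<omega> \<pi>)))"
        moreover from this have "set ks \<subseteq> G" unfolding fst using sub gs by (auto simp: tup_def)
        ultimately show "cob f ks = 0"
          by (intro f[rule_format] tupI) (auto simp: q_def zs_def len)
      qed
      also have "\<dots> = 0" using prism_diff[of "\<lambda>_. 0" "\<lambda>_. 0"] by simp
      finally show "cob (prism f) (q gs (zs \<omega> \<pi>)) = f (map2 (\<circ>) (map p gs) (zs \<omega> \<pi>)) - f gs"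
        using prism_homotopy[of f "q gs (zs \<omega> \<pi>)"] fst snd by simp
    qed
    finally show ?thesis .
  qed
  have "cob (\<lambda>gs. (\<Sum>\<omega>\<in>\<Omega>. \<Sum>\<pi>\<in>?P. prism f (q gs (map (\<lambda>j. z \<omega> (\<pi> j)) [0..<n]))) / N) gs
      = (\<Sum>\<omega>\<in>\<Omega>. \<Sum>\<pi>\<in>?P. f (map2 (\<circ>) (map p gs) (zs \<omega> \<pi>)) - f gs) / N"
    unfolding cob_divide cob_sum[where I = \<Omega>] by (simp add: step cong: sum.cong)
  also have "\<dots> = (\<Sum>\<omega>\<in>\<Omega>. \<Sum>\<pi>\<in>?P. f (map2 (\<circ>) (map p gs) (zs \<omega> \<pi>))) / N - f gs"
    using N card_permutations[of "{..n}" "Suc n"]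
    by (auto simp: sum_subtractf diff_divide_distrib N_def simp del: fact_Suc)
  finally show ?thesis by (simp add: q_def zs_def del: upt_Suc)
qed

text \<open>For every finite \<open>S \<subseteq> K\<close> there are arbitrarily many commuting conjugates of \<open>S\<close> in \<open>K\<close> that
  \<open>K\<close> permutes arbitrarily: \<open>\<beta> \<sigma> c\<close> applies \<open>c i\<close> on the \<open>i\<close>-th block and then permutes the blocks
  by \<open>\<sigma>\<close>. Block \<open>0\<close> carries \<open>S\<close> itself.\<close>

definition displaceable :: "('a \<Rightarrow> 'a) set \<Rightarrow> bool" where
  "displaceable K \<longleftrightarrow> (\<forall>S M. finite S \<and> S \<subseteq> K \<longrightarrow>
     (\<exists>\<beta>::(nat \<Rightarrow> nat) \<Rightarrow> (nat \<Rightarrow> 'a \<Rightarrow> 'a) \<Rightarrow> 'a \<Rightarrow> 'a.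
        (\<forall>\<sigma> c. \<sigma> permutes {..M} \<and> range c \<subseteq> insert id S \<longrightarrow> \<beta> \<sigma> c \<in> K) \<and>
        (\<forall>\<sigma> \<tau> c d. \<sigma> permutes {..M} \<and> \<tau> permutes {..M} \<and>
           range c \<subseteq> insert id S \<and> range d \<subseteq> insert id S \<longrightarrow>
           \<beta> \<sigma> c \<circ> \<beta> \<tau> d = \<beta> (\<sigma> \<circ> \<tau>) (\<lambda>i. c (\<tau> i) \<circ> d i)) \<and>
        (\<forall>h\<in>S. \<beta> id ((\<lambda>_. id)(0 := h)) = h)))"

section \<open>Averages over random fillings of the blocks\<close>

text \<open>The sum along coordinate w telescopes and leaves two opposite faces with
  \<open>R ^ (card W - 1)\<close> points each. The face with value R at w lies just outside the box,
  hence the bound B for all m.\<close>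

lemma box_shift_bound:
  fixes \<Psi> :: "('b \<Rightarrow> nat) \<Rightarrow> real"
  assumes "finite W" "w \<in> W" and B: "\<And>m. \<bar>\<Psi> m\<bar> \<le> B"
  shows "\<bar>(\<Sum>m\<in>PiE W (\<lambda>_. {..<R}). \<Psi> (m(w := Suc (m w)))) - (\<Sum>m\<in>PiE W (\<lambda>_. {..<R}). \<Psi> m)\<bar>
         \<le> 2 * B * R ^ (card W - 1)"
proof -
  define W' where "W' = W - {w}"
  have W: "W = insert w W'" "w \<notin> W'" "finite W'" using assms by (auto simp: W'_def)
  let ?Q = "PiE W' (\<lambda>_. {..<R})"
  have S: "(\<Sum>m\<in>PiE W (\<lambda>_. {..<R}). F m) = (\<Sum>m\<in>?Q. \<Sum>y<R. F (m(w := y)))" for F :: "_ \<Rightarrow> real"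
  proof -
    have "(\<Sum>m\<in>PiE W (\<lambda>_. {..<R}). F m) = (\<Sum>(y, m)\<in>{..<R} \<times> ?Q. F (m(w := y)))"
      unfolding W(1) PiE_insert_eq
      by (subst sum.reindex[OF inj_combinator[OF W(2)]]) (simp add: case_prod_unfold comp_def)
    also have "\<dots> = (\<Sum>m\<in>?Q. \<Sum>y<R. F (m(w := y)))"
      by (subst sum.cartesian_product[symmetric]) (rule sum.swap)
    finally show ?thesis .
  qed
  have "(\<Sum>m\<in>PiE W (\<lambda>_. {..<R}). \<Psi> (m(w := Suc (m w)))) - (\<Sum>m\<in>PiE W (\<lambda>_. {..<R}). \<Psi> m)
      = (\<Sum>m\<in>?Q. \<Sum>y<R. \<Psi> (m(w := Suc y)) - \<Psi> (m(w := y)))"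
    by (simp add: S sum_subtractf)
  also have "\<dots> = (\<Sum>m\<in>?Q. \<Psi> (m(w := R)) - \<Psi> (m(w := 0)))"
    by (simp add: sum_lessThan_telescope[where f = "\<lambda>y. \<Psi> (_(w := y))"])
  finally have "\<bar>(\<Sum>m\<in>PiE W (\<lambda>_. {..<R}). \<Psi> (m(w := Suc (m w)))) - (\<Sum>m\<in>PiE W (\<lambda>_. {..<R}). \<Psi> m)\<bar>
      \<le> (\<Sum>m\<in>?Q. \<bar>\<Psi> (m(w := R)) - \<Psi> (m(w := 0))\<bar>)"
    by simp
  also have "\<dots> \<le> (\<Sum>m\<in>?Q. 2 * B)"
  proof (rule sum_mono)
    fix m show "\<bar>\<Psi> (m(w := R)) - \<Psi> (m(w := 0))\<bar> \<le> 2 * B"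
      using B[of "m(w := R)"] B[of "m(w := 0)"] by linarith
  qed
  also have "\<dots> = 2 * B * R ^ (card W - 1)"
    using W by (simp add: card_PiE)
  finally show ?thesis .
qed

text \<open>A random tuple in \<open>K\<close> is obtained by putting, for each \<open>w \<in> S\<^bsup>n+1\<^esup>\<close>, the elements of \<open>w\<close> on
  \<open>m w\<close> of the blocks, with \<open>m\<close> uniform in a box of side \<open>R\<close>, and then permuting blocks and
  coordinates at random. Multiplying by \<open>hs\<close> fills the empty block \<open>0\<close>; since only the number of
  blocks of each kind matters, this amounts to raising one \<open>m w\<close> by \<open>1\<close>, which changes the
  average over the box by \<open>O(1/R)\<close>.\<close>

lemma displaceable_average:
  fixes f :: "('a \<Rightarrow> 'a) list \<Rightarrow> real" and R :: nat
  assumes K: "perm_group K" and disp: "displaceable K"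
    and S: "finite S" "S \<subseteq> K" and R: "R > 0"
    and "\<forall>k\<in>K. \<forall>gs\<in>tup (Suc n) K. f (map ((\<circ>) k) gs) = f gs"
    and "\<forall>gs\<in>tup (Suc n) K. \<bar>f gs\<bar> \<le> B"
  shows "\<exists>(\<Omega> :: ((('a \<Rightarrow> 'a) list \<Rightarrow> nat) \<times> (nat \<Rightarrow> nat)) set) z c.
    finite \<Omega> \<and> \<Omega> \<noteq> {} \<and> (\<forall>\<omega>\<in>\<Omega>. \<forall>j\<le>n. z \<omega> j \<in> K) \<and> \<bar>c\<bar> \<le> B \<and>
    (\<forall>hs\<in>tup (Suc n) S.
      \<bar>(\<Sum>\<omega>\<in>\<Omega>. \<Sum>\<pi> | \<pi> permutes {..n}. f (map2 (\<circ>) hs (map (\<lambda>j. z \<omega> (\<pi> j)) [0..<Suc n])))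
          / (card \<Omega> * fact (Suc n)) - c\<bar> \<le> 2 * B / R)"
proof -
  interpret K: perm_group K by fact
  note inv = assms(6)[rule_format] and B = assms(7)[rule_format]
  define ones where "ones = replicate (Suc n) (id :: 'a \<Rightarrow> 'a)"
  define W where "W = tup (Suc n) S"
  have finW: "finite W" using S by (simp add: W_def finite_tup)
  \<comment> \<open>Each type w in W gets R slots, numbered by h from 1 to M. Block 0 stays outside
    this numbering and is kept free for hs.\<close>
  define M where "M = card (W \<times> {..<R})"
  obtain h where h: "bij_betw h {1..M} (W \<times> {..<R})"
    using ex_bij_betw_nat_finite_1[of "W \<times> {..<R}"] finW unfolding M_def by (meson finite_SigmaI finite_lessThan)
  obtain \<beta> :: "(nat \<Rightarrow> nat) \<Rightarrow> (nat \<Rightarrow> 'a \<Rightarrow> 'a) \<Rightarrow> 'a \<Rightarrow> 'a" where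
    mem: "\<And>\<sigma> c. \<sigma> permutes {..M} \<Longrightarrow> range c \<subseteq> insert id S \<Longrightarrow> \<beta> \<sigma> c \<in> K" and
    hom: "\<And>\<sigma> \<tau> c d. \<sigma> permutes {..M} \<Longrightarrow> \<tau> permutes {..M} \<Longrightarrow> range c \<subseteq> insert id S \<Longrightarrow>
            range d \<subseteq> insert id S \<Longrightarrow> \<beta> \<sigma> c \<circ> \<beta> \<tau> d = \<beta> (\<sigma> \<circ> \<tau>) (\<lambda>i. c (\<tau> i) \<circ> d i)" and
    base: "\<And>g. g \<in> S \<Longrightarrow> \<beta> id ((\<lambda>_. id)(0 := g)) = g"
  proof -
    have "finite S \<and> S \<subseteq> K" using S by simp
    from disp[unfolded displaceable_def, rule_format, OF this, of M]
    obtain \<beta> :: "(nat \<Rightarrow> nat) \<Rightarrow> (nat \<Rightarrow> 'a \<Rightarrow> 'a) \<Rightarrow> 'a \<Rightarrow> 'a" where \<beta>: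
      "\<forall>\<sigma> c. \<sigma> permutes {..M} \<and> range c \<subseteq> insert id S \<longrightarrow> \<beta> \<sigma> c \<in> K"
      "\<forall>\<sigma> \<tau> c d. \<sigma> permutes {..M} \<and> \<tau> permutes {..M} \<and>
         range c \<subseteq> insert id S \<and> range d \<subseteq> insert id S \<longrightarrow>
         \<beta> \<sigma> c \<circ> \<beta> \<tau> d = \<beta> (\<sigma> \<circ> \<tau>) (\<lambda>i. c (\<tau> i) \<circ> d i)"
      "\<forall>h\<in>S. \<beta> id ((\<lambda>_. id)(0 := h)) = h"
      by (elim exE conjE)
    show ?thesis
      by (rule that[OF \<beta>(1)[rule_format, OF conjI]
            \<beta>(2)[rule_format, OF conjI[OF _ conjI[OF _ conjI]]] \<beta>(3)[rule_format]])
  qed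
  \<comment> \<open>Type w fills those of its slots whose number is below \<open>m w\<close>, so it
    occurs \<open>m w\<close> times as long as \<open>m w\<close> is at most R; \<open>ones\<close>
    marks an empty block.\<close>
  define cfg where "cfg m i = (if 1 \<le> i \<and> i \<le> M \<and> snd (h i) < m (fst (h i)) then fst (h i) else ones)"
    for m :: "('a \<Rightarrow> 'a) list \<Rightarrow> nat" and i
  define good where "good c \<longleftrightarrow> range c \<subseteq> insert ones W" for c :: "nat \<Rightarrow> ('a \<Rightarrow> 'a) list"
  define Z where "Z c j = \<beta> id (\<lambda>i. c i ! j)" for c :: "nat \<Rightarrow> ('a \<Rightarrow> 'a) list" and j
  define P where "P \<sigma> = \<beta> \<sigma> (\<lambda>_. id)" for \<sigma>
  define \<Theta> where "\<Theta> c \<sigma> \<pi> = f (map (\<lambda>j. Z c (\<pi> j) \<circ> P \<sigma>) [0..<Suc n])" for c \<sigma> \<pi>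
  define \<Phi> where "\<Phi> \<pi> c = (\<Sum>\<sigma> | \<sigma> permutes {..M}. \<Theta> c \<sigma> \<pi>)" for \<pi> c
  let ?P = "{\<sigma>. \<sigma> permutes {..M}}" and ?Q = "{\<pi>. \<pi> permutes {..n}}"
  define Box where "Box = PiE W (\<lambda>_. {..<R})"
  have finBox: "finite Box" using finW by (auto simp: Box_def intro: finite_PiE)
  have cardBox: "card Box = R ^ card W" using finW by (simp add: Box_def card_PiE)
  have cardP: "card ?P = fact (Suc M)" and cardQ: "card ?Q = fact (Suc n)"
    using card_permutations[of "{..M}" "Suc M"] card_permutations[of "{..n}" "Suc n"] by auto
  have perm_le: "\<pi> j \<le> n" if "\<pi> permutes {..n}" "j \<le> n" for \<pi> j
    using permutes_in_image[OF that(1), of j] that(2) by simp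

  have ent: "range (\<lambda>i. c i ! j) \<subseteq> insert id S" if "good c" "j \<le> n" for c j
  proof
    fix x assume "x \<in> range (\<lambda>i. c i ! j)"
    then obtain i where i: "x = c i ! j" by auto
    have "c i \<in> insert ones W" using that(1) by (auto simp: good_def)
    then show "x \<in> insert id S"
      using that(2) i nth_tup[of "c i" "Suc n" S j] by (auto simp: ones_def W_def simp del: replicate_Suc)
  qed
  have ids: "range (\<lambda>_. id) \<subseteq> insert (id :: 'a \<Rightarrow> 'a) S" by auto
  have ZK: "Z c j \<in> K" if "good c" "j \<le> n" for c j
    unfolding Z_def by (intro mem ent that permutes_id)
  have PK: "P \<sigma> \<in> K" if "\<sigma> permutes {..M}" for \<sigma>
    unfolding P_def by (intro mem ids that)
  have PP: "P \<rho> \<circ> P \<sigma> = P (\<rho> \<circ> \<sigma>)" if "\<sigma> permutes {..M}" "\<rho> permutes {..M}" for \<sigma> \<rho>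
    unfolding P_def by (subst hom[OF that(2,1) ids ids]) simp
  have good_cfg: "good (cfg m)" for m
  proof -
    have "fst (h i) \<in> W" if "1 \<le> i" "i \<le> M" for i
      using bij_betwE[OF h] that by (metis atLeastAtMost_iff mem_Sigma_iff prod.collapse)
    then show ?thesis by (auto simp: good_def cfg_def)
  qed
  have tupK: "map (\<lambda>j. Z c (\<pi> j) \<circ> P \<sigma>) [0..<Suc n] \<in> tup (Suc n) K"
    if "good c" "\<sigma> permutes {..M}" "\<pi> permutes {..n}" for c \<sigma> \<pi>
    using ZK[OF that(1) perm_le[OF that(3)]] PK[OF that(2)] by (auto intro!: tupI K.comp_mem)

  have conj: "Z (c \<circ> \<rho>) j = P (finv \<rho>) \<circ> Z c j \<circ> P \<rho>"
    if "good c" "j \<le> n" "\<rho> permutes {..M}" for c j \<rho>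
  proof -
    have "P (finv \<rho>) \<circ> Z c j = \<beta> (finv \<rho>) (\<lambda>i. c i ! j)"
      unfolding P_def Z_def
      by (subst hom[OF permutes_inv[OF that(3)] permutes_id ids ent[OF that(1,2)]]) simp
    then have "P (finv \<rho>) \<circ> Z c j \<circ> P \<rho> = \<beta> (finv \<rho> \<circ> \<rho>) (\<lambda>i. c (\<rho> i) ! j)"
      unfolding P_def
      by (simp add: hom[OF permutes_inv[OF that(3)] that(3) ent[OF that(1,2)] ids])
    then show ?thesis by (simp add: Z_def permutes_inv_o[OF that(3)])
  qed
  \<comment> \<open>Permuting the blocks by \<rho> conjugates every entry by
    \<open>P \<rho>\<close>. The left factor disappears by invariance of f, the right one is
    absorbed by the sum over \<sigma>.\<close>
  have \<Phi>_perm: "\<Phi> \<pi> (c \<circ> \<rho>) = \<Phi> \<pi> c"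
    if c: "good c" and \<rho>: "\<rho> permutes {..M}" and \<pi>: "\<pi> permutes {..n}" for \<pi> c \<rho>
  proof -
    have "\<Theta> (c \<circ> \<rho>) \<sigma> \<pi> = \<Theta> c (\<rho> \<circ> \<sigma>) \<pi>" if \<sigma>: "\<sigma> permutes {..M}" for \<sigma>
    proof -
      have "Z (c \<circ> \<rho>) (\<pi> j) \<circ> P \<sigma> = P (finv \<rho>) \<circ> (Z c (\<pi> j) \<circ> P (\<rho> \<circ> \<sigma>))" if "j \<le> n" for j
        unfolding conj[OF c perm_le[OF \<pi> that] \<rho>] PP[OF \<sigma> \<rho>, symmetric] by (simp add: comp_assoc)
      then have "map (\<lambda>j. Z (c \<circ> \<rho>) (\<pi> j) \<circ> P \<sigma>) [0..<Suc n] =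
          map ((\<circ>) (P (finv \<rho>))) (map (\<lambda>j. Z c (\<pi> j) \<circ> P (\<rho> \<circ> \<sigma>)) [0..<Suc n])"
        by simp
      then show ?thesis
        using inv[OF PK[OF permutes_inv[OF \<rho>]] tupK[OF c permutes_compose[OF \<sigma> \<rho>] \<pi>]]
        by (simp only: \<Theta>_def)
    qed
    then show ?thesis
      unfolding \<Phi>_def by (subst (2) setum_permutations_compose_left[OF \<rho>]) simp
  qed
  have \<Theta>_bound: "\<bar>\<Theta> c \<sigma> \<pi>\<bar> \<le> B"
    if "good c" "\<sigma> permutes {..M}" "\<pi> permutes {..n}" for c \<sigma> \<pi>
    unfolding \<Theta>_def by (rule B[OF tupK[OF that]])
  have \<Phi>_bound: "\<bar>\<Phi> \<pi> c\<bar> \<le> fact (Suc M) * B" if "good c" "\<pi> permutes {..n}" for c \<pi>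
  proof -
    have "\<bar>\<Phi> \<pi> c\<bar> \<le> (\<Sum>\<sigma>\<in>?P. \<bar>\<Theta> c \<sigma> \<pi>\<bar>)" unfolding \<Phi>_def by (rule sum_abs)
    also have "\<dots> \<le> (\<Sum>\<sigma>\<in>?P. B)" by (intro sum_mono \<Theta>_bound that) auto
    finally show ?thesis by (simp add: cardP del: fact_Suc)
  qed

  \<comment> \<open>Here i is the first empty slot of type w: filling block 0 or filling slot i
    gives the same configuration up to the transposition of 0 and i.\<close>
  have insert_type: "(cfg m)(0 := w) = cfg (m(w := Suc (m w))) \<circ> Transposition.transpose 0 i"
    if "h i = (w, m w)" "i \<in> {1..M}" for m w i
  proof -
    have i: "1 \<le> i" "i \<le> M" using that(2) by auto
    show "(cfg m)(0 := w) = cfg (m(w := Suc (m w))) \<circ> Transposition.transpose 0 i"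
    proof
      fix j
      consider "j = 0" | "j = i" | "j \<noteq> 0" "j \<noteq> i" by blast
      then show "((cfg m)(0 := w)) j = (cfg (m(w := Suc (m w))) \<circ> Transposition.transpose 0 i) j"
      proof cases
        case 1 then show ?thesis using that i by (simp add: cfg_def)
      next
        case 2 then show ?thesis using that i by (simp add: cfg_def)
      next
        case 3
        have "h j \<noteq> (w, m w)" if "1 \<le> j" "j \<le> M"
          using 3 that \<open>h i = (w, m w)\<close> i bij_betw_imp_inj_on[OF h]
          by (metis atLeastAtMost_iff inj_on_eq_iff)
        then have "snd (h j) < (m(w := Suc (m w))) (fst (h j)) \<longleftrightarrow> snd (h j) < m (fst (h j))"
          if "1 \<le> j" "j \<le> M"
          using that by (cases "h j") (auto simp: less_Suc_eq)
        then show ?thesis using 3 by (auto simp: cfg_def)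
      qed
    qed
  qed
  have \<Phi>_insert: "\<Phi> \<pi> ((cfg m)(0 := w)) = \<Phi> \<pi> (cfg (m(w := Suc (m w))))"
    if "m \<in> Box" "w \<in> W" "\<pi> permutes {..n}" for m w \<pi>
  proof -
    have "(w, m w) \<in> W \<times> {..<R}" using that by (auto simp: Box_def PiE_def)
    then obtain i where i: "i \<in> {1..M}" "h i = (w, m w)"
      using bij_betw_imp_surj_on[OF h] by (metis imageE)
    have eq: "(cfg m)(0 := w) = cfg (m(w := Suc (m w))) \<circ> Transposition.transpose 0 i"
      by (rule insert_type) (use i in auto)
    show ?thesis
      unfolding eq
      by (rule \<Phi>_perm[OF good_cfg _ that(3)]) (use i in \<open>auto intro: permutes_swap_id\<close>)
  qed

  \<comment> \<open>Entry j of the tuple uses coordinate \<pi> j of the configuration, so block 0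
    has to receive hs rearranged by the inverse of \<pi>.\<close>
  have left_mult: "f (map2 (\<circ>) hs (map (\<lambda>j. Z (cfg m) (\<pi> j) \<circ> P \<sigma>) [0..<Suc n]))
      = \<Theta> ((cfg m)(0 := map (\<lambda>j. hs ! finv \<pi> j) [0..<Suc n])) \<sigma> \<pi>"
    if hs: "hs \<in> W" and \<pi>: "\<pi> permutes {..n}" for hs m \<sigma> \<pi>
  proof -
    let ?w = "map (\<lambda>j. hs ! finv \<pi> j) [0..<Suc n]"
    have len: "length hs = Suc n" using hs by (simp add: W_def tup_def)
    have "hs ! j \<circ> (Z (cfg m) (\<pi> j) \<circ> P \<sigma>) = Z ((cfg m)(0 := ?w)) (\<pi> j) \<circ> P \<sigma>" if j: "j \<le> n" for j
    proof -
      have hj: "hs ! j \<in> S" using hs j by (simp add: W_def nth_tup)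
      have "hs ! j \<circ> Z (cfg m) (\<pi> j) = \<beta> id ((\<lambda>_. id)(0 := hs ! j)) \<circ> \<beta> id (\<lambda>i. cfg m i ! \<pi> j)"
        by (simp add: base[OF hj] Z_def)
      also have "\<dots> = \<beta> id (\<lambda>i. ((\<lambda>_. id)(0 := hs ! j)) i \<circ> cfg m i ! \<pi> j)"
        by (subst hom[OF permutes_id permutes_id _ ent[OF good_cfg perm_le[OF \<pi> j]]])
          (use hj in auto)
      also have "(\<lambda>i. ((\<lambda>_. id)(0 := hs ! j)) i \<circ> cfg m i ! \<pi> j) = (\<lambda>i. ((cfg m)(0 := ?w)) i ! \<pi> j)"
        using perm_le[OF \<pi> j] permutes_inverses(2)[OF \<pi>]
        by (auto simp: fun_eq_iff cfg_def ones_def simp del: replicate_Suc upt_Suc)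
      finally show ?thesis by (simp only: Z_def comp_assoc[symmetric])
    qed
    then have "map2 (\<circ>) hs (map (\<lambda>j. Z (cfg m) (\<pi> j) \<circ> P \<sigma>) [0..<Suc n])
        = map (\<lambda>j. Z ((cfg m)(0 := ?w)) (\<pi> j) \<circ> P \<sigma>) [0..<Suc n]"
      by (intro nth_equalityI) (auto simp: len simp del: upt_Suc)
    then show ?thesis by (simp add: \<Theta>_def)
  qed
  have w_mem: "map (\<lambda>j. hs ! finv \<pi> j) [0..<Suc n] \<in> W" if "hs \<in> W" "\<pi> permutes {..n}" for hs \<pi>
    unfolding W_def
  proof (rule tupI)
    show "set (map (\<lambda>j. hs ! finv \<pi> j) [0..<Suc n]) \<subseteq> S"
    proof
      fix x assume "x \<in> set (map (\<lambda>j. hs ! finv \<pi> j) [0..<Suc n])"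
      then obtain j where "j \<le> n" "x = hs ! finv \<pi> j"
        by (auto simp: less_Suc_eq_le simp del: upt_Suc)
      then show "x \<in> S"
        using perm_le[OF permutes_inv[OF that(2)]] that(1) nth_tup[of hs "Suc n" S "finv \<pi> j"]
        by (simp add: W_def less_Suc_eq_le)
    qed
  qed simp

  define \<Omega> where "\<Omega> = Box \<times> ?P"
  define z where "z \<omega> j = Z (cfg (fst \<omega>)) j \<circ> P (snd \<omega>)" for \<omega> j
  define N where "N = real (card \<Omega>) * fact (Suc n)"
  \<comment> \<open>The comparison value is the average with block 0 left empty, which does not
    depend on hs.\<close>
  define c where "c = (\<Sum>\<pi>\<in>?Q. \<Sum>m\<in>Box. \<Phi> \<pi> (cfg m)) / N"
  have finP: "finite ?P" by (simp add: finite_permutations)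
  have card\<Omega>: "card \<Omega> = R ^ card W * fact (Suc M)"
    unfolding \<Omega>_def card_cartesian_product cardBox cardP ..
  have Npos: "N > 0" using R by (simp add: N_def card\<Omega> del: fact_Suc)
  have N_eq: "N = real R ^ card W * fact (Suc M) * fact (Suc n)"
    by (simp add: N_def card\<Omega> del: fact_Suc)
  have fin\<Omega>: "finite \<Omega>" by (simp add: \<Omega>_def finBox finP)
  have ne: "\<Omega> \<noteq> {}" using card\<Omega> R by (metis card.empty fact_nonzero mult_eq_0_iff not_gr0 power_not_zero)
  have zK: "\<forall>\<omega>\<in>\<Omega>. \<forall>j\<le>n. z \<omega> j \<in> K"
    using ZK[OF good_cfg] PK by (auto simp: \<Omega>_def z_def intro!: K.comp_mem)
  have c: "\<bar>c\<bar> \<le> B"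
  proof -
    have "\<bar>\<Sum>\<pi>\<in>?Q. \<Sum>m\<in>Box. \<Phi> \<pi> (cfg m)\<bar> \<le> (\<Sum>\<pi>\<in>?Q. \<bar>\<Sum>m\<in>Box. \<Phi> \<pi> (cfg m)\<bar>)"
      by (rule sum_abs)
    also have "\<dots> \<le> (\<Sum>\<pi>\<in>?Q. \<Sum>m\<in>Box. \<bar>\<Phi> \<pi> (cfg m)\<bar>)"
      by (intro sum_mono sum_abs)
    also have "\<dots> \<le> (\<Sum>\<pi>\<in>?Q. \<Sum>m\<in>Box. fact (Suc M) * B)"
      by (intro sum_mono \<Phi>_bound good_cfg) auto
    also have "\<dots> = N * B"
      by (simp add: N_eq cardBox cardQ mult_ac del: fact_Suc)
    finally show ?thesis using Npos by (simp add: c_def pos_divide_le_eq mult.commute)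
  qed
  have main: "\<bar>(\<Sum>\<omega>\<in>\<Omega>. \<Sum>\<pi>\<in>?Q. f (map2 (\<circ>) hs (map (\<lambda>j. z \<omega> (\<pi> j)) [0..<Suc n]))) / N - c\<bar> \<le> 2 * B / R"
    if hs: "hs \<in> W" for hs
  proof -
    define w where "w \<pi> = map (\<lambda>j. hs ! finv \<pi> j) [0..<Suc n]" for \<pi>
    have "(\<Sum>\<omega>\<in>\<Omega>. \<Sum>\<pi>\<in>?Q. f (map2 (\<circ>) hs (map (\<lambda>j. z \<omega> (\<pi> j)) [0..<Suc n])))
        = (\<Sum>\<pi>\<in>?Q. \<Sum>m\<in>Box. \<Sum>\<sigma>\<in>?P. f (map2 (\<circ>) hs (map (\<lambda>j. z (m, \<sigma>) (\<pi> j)) [0..<Suc n])))"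
      unfolding \<Omega>_def by (subst sum.swap) (simp add: sum.cartesian_product case_prod_unfold)
    also have "\<dots> = (\<Sum>\<pi>\<in>?Q. \<Sum>m\<in>Box. \<Phi> \<pi> ((cfg m)(0 := w \<pi>)))"
      unfolding \<Phi>_def w_def z_def fst_conv snd_conv
      by (intro sum.cong refl left_mult hs) auto
    also have "\<dots> = (\<Sum>\<pi>\<in>?Q. \<Sum>m\<in>Box. \<Phi> \<pi> (cfg (m(w \<pi> := Suc (m (w \<pi>))))))"
      unfolding w_def by (intro sum.cong refl \<Phi>_insert w_mem hs) auto
    finally have "(\<Sum>\<omega>\<in>\<Omega>. \<Sum>\<pi>\<in>?Q. f (map2 (\<circ>) hs (map (\<lambda>j. z \<omega> (\<pi> j)) [0..<Suc n]))) / N - c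
        = (\<Sum>\<pi>\<in>?Q. (\<Sum>m\<in>Box. \<Phi> \<pi> (cfg (m(w \<pi> := Suc (m (w \<pi>)))))) - (\<Sum>m\<in>Box. \<Phi> \<pi> (cfg m))) / N"
      by (simp add: c_def sum_subtractf diff_divide_distrib)
    moreover have "\<bar>\<Sum>\<pi>\<in>?Q. (\<Sum>m\<in>Box. \<Phi> \<pi> (cfg (m(w \<pi> := Suc (m (w \<pi>)))))) - (\<Sum>m\<in>Box. \<Phi> \<pi> (cfg m))\<bar>
        \<le> (\<Sum>\<pi>\<in>?Q. 2 * (fact (Suc M) * B) * R ^ (card W - 1))"
    proof (rule order_trans[OF sum_abs sum_mono])
      fix \<pi> assume "\<pi> \<in> ?Q"
      then have \<pi>: "\<pi> permutes {..n}" by simp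
      show "\<bar>(\<Sum>m\<in>Box. \<Phi> \<pi> (cfg (m(w \<pi> := Suc (m (w \<pi>)))))) - (\<Sum>m\<in>Box. \<Phi> \<pi> (cfg m))\<bar>
          \<le> 2 * (fact (Suc M) * B) * R ^ (card W - 1)"
        unfolding Box_def
        by (rule box_shift_bound[OF finW, of "w \<pi>" "\<lambda>m. \<Phi> \<pi> (cfg m)"])
          (use w_mem[OF hs \<pi>] \<Phi>_bound[OF good_cfg \<pi>] in \<open>auto simp: w_def\<close>)
    qed
    ultimately have "\<bar>(\<Sum>\<omega>\<in>\<Omega>. \<Sum>\<pi>\<in>?Q. f (map2 (\<circ>) hs (map (\<lambda>j. z \<omega> (\<pi> j)) [0..<Suc n]))) / N - c\<bar>
        \<le> (fact (Suc n) * (2 * (fact (Suc M) * B) * R ^ (card W - 1))) / N"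
      using Npos by (simp add: cardQ divide_right_mono abs_div_pos[symmetric] del: fact_Suc)
    \<comment> \<open>A face is the fraction 1 / R of the box, and the factorials cancel against
      N.\<close>
    also have "\<dots> = 2 * B / R"
    proof -
      have "card W > 0" using hs finW by (auto simp: card_gt_0_iff)
      then have "real R ^ card W = R * real R ^ (card W - 1)"
        by (metis Suc_diff_1 power_Suc)
      then show ?thesis using R by (simp add: N_eq field_simps del: fact_Suc)
    qed
    finally show ?thesis .
  qed
  show ?thesis
    by (intro exI[of _ \<Omega>] exI[of _ z] exI[of _ c] conjI fin\<Omega> ne zK c ballI)
      (use main in \<open>simp add: N_def W_def del: fact_Suc upt_Suc\<close>)
qed

section \<open>From almost constant cocycles to primitives\<close>

text \<open>Combines the averaged homotopy with the random tuple of
  \<open>displaceable_average\<close>. The bounds on E and c involve neither S nor R, which is what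
  the passage to the limit requires.\<close>

lemma displaceable_approx:
  fixes f :: "('a \<Rightarrow> 'a) list \<Rightarrow> real" and R :: nat
  assumes G: "perm_group G" and K: "perm_group K" "K \<subseteq> G" and disp: "displaceable K"
    and p: "\<forall>g\<in>G. p g \<in> K" "\<forall>k\<in>K. \<forall>g. p (k \<circ> g) = k \<circ> p g"
    and cocycle: "\<forall>gs\<in>tup (Suc (Suc n)) G. cob f gs = 0"
    and inv: "\<forall>k\<in>K. \<forall>gs\<in>tup (Suc n) G. f (map ((\<circ>) k) gs) = f gs"
    and B: "\<forall>gs\<in>tup (Suc n) G. \<bar>f gs\<bar> \<le> B"
    and S: "finite S" "S \<subseteq> K" and R: "R > 0"
  shows "\<exists>E c. \<bar>c\<bar> \<le> B \<and>
    (\<forall>gs\<in>tup n G. \<bar>E gs\<bar> \<le> n * B \<and> (\<forall>k\<in>K. E (map ((\<circ>) k) gs) = E gs)) \<and>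
    (\<forall>gs\<in>tup (Suc n) G. p ` set gs \<subseteq> S \<longrightarrow> \<bar>f gs + cob E gs - c\<bar> \<le> 2 * B / R)"
proof -
  interpret G: perm_group G by fact
  interpret K: perm_group K by fact
  have sub: "gs \<in> tup m G" if "gs \<in> tup m K" for gs m
    using that K(2) by (auto simp: tup_def)
  have inv': "\<forall>k\<in>K. \<forall>gs\<in>tup (Suc n) K. f (map ((\<circ>) k) gs) = f gs"
    using inv sub by blast
  have B': "\<forall>gs\<in>tup (Suc n) K. \<bar>f gs\<bar> \<le> B"
    using B sub by blast
  from displaceable_average[where n = n and f = f and B = B, OF K(1) disp S R inv' B']
  obtain \<Omega> :: "((('a \<Rightarrow> 'a) list \<Rightarrow> nat) \<times> (nat \<Rightarrow> nat)) set" and z c where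
    \<Omega>: "finite \<Omega>" "\<Omega> \<noteq> {}" and z: "\<forall>\<omega>\<in>\<Omega>. \<forall>j\<le>n. z \<omega> j \<in> K" and c: "\<bar>c\<bar> \<le> B" and
    est: "\<forall>hs\<in>tup (Suc n) S.
      \<bar>(\<Sum>\<omega>\<in>\<Omega>. \<Sum>\<pi> | \<pi> permutes {..n}. f (map2 (\<circ>) hs (map (\<lambda>j. z \<omega> (\<pi> j)) [0..<Suc n])))
          / (card \<Omega> * fact (Suc n)) - c\<bar> \<le> 2 * B / R"
    by (elim exE conjE)
  define N where "N = real (card \<Omega>) * fact (Suc n)"
  have N: "N > 0" using \<Omega> by (simp add: N_def card_gt_0_iff)
  define q where "q gs ks = map2 (\<lambda>g k. (g, p g \<circ> k)) gs ks" for gs ks :: "('a \<Rightarrow> 'a) list"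
  define E where "E gs = (\<Sum>\<omega>\<in>\<Omega>. \<Sum>\<pi> | \<pi> permutes {..n}.
             prism f (q gs (map (\<lambda>j. z \<omega> (\<pi> j)) [0..<n]))) / N" for gs
  have zs: "set (map (\<lambda>j. z \<omega> (\<pi> j)) [0..<n]) \<subseteq> K" if "\<omega> \<in> \<Omega>" "\<pi> permutes {..n}" for \<omega> \<pi>
    using z that(1) permutes_in_image[OF that(2)] by auto
  have q_sub: "set (map fst (q gs ks)) \<union> set (map snd (q gs ks)) \<subseteq> G"
    if "gs \<in> tup n G" "set ks \<subseteq> K" for gs ks
  proof -
    have "g \<in> G \<and> p g \<circ> k \<in> G" if "(g, k) \<in> set (zip gs ks)" for g k
      using that set_zip_leftD[OF that] set_zip_rightD[OF that] \<open>gs \<in> tup n G\<close> \<open>set ks \<subseteq> K\<close> p(1) K(2)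
      by (auto simp: tup_def intro!: G.comp_mem)
    then show ?thesis by (auto simp: q_def)
  qed
  have "\<bar>E gs\<bar> \<le> n * B" if gs: "gs \<in> tup n G" for gs
  proof -
    have "\<bar>\<Sum>\<omega>\<in>\<Omega>. \<Sum>\<pi> | \<pi> permutes {..n}. prism f (q gs (map (\<lambda>j. z \<omega> (\<pi> j)) [0..<n]))\<bar>
        \<le> (\<Sum>\<omega>\<in>\<Omega>. \<Sum>\<pi> | \<pi> permutes {..n}. n * B)"
    proof (intro order_trans[OF sum_abs sum_mono] )
      fix \<omega> \<pi> assume *: "\<omega> \<in> \<Omega>" "\<pi> \<in> {\<pi>. \<pi> permutes {..n}}"
      have len: "length (q gs (map (\<lambda>j. z \<omega> (\<pi> j)) [0..<n])) = n"
        using gs by (simp add: q_def tup_def)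
      show "\<bar>prism f (q gs (map (\<lambda>j. z \<omega> (\<pi> j)) [0..<n]))\<bar> \<le> n * B"
      proof (rule order_trans[OF abs_prism_le])
        fix ks assume "length ks = Suc (length (q gs (map (\<lambda>j. z \<omega> (\<pi> j)) [0..<n])))"
          "set ks \<subseteq> set (map fst (q gs (map (\<lambda>j. z \<omega> (\<pi> j)) [0..<n])))
             \<union> set (map snd (q gs (map (\<lambda>j. z \<omega> (\<pi> j)) [0..<n])))"
        then show "\<bar>f ks\<bar> \<le> B"
          using q_sub[OF gs zs[of \<omega> \<pi>]] * by (intro B[rule_format] tupI) (auto simp: len)
      qed (simp add: len)
    qed
    also have "\<dots> = N * (n * B)"
      using card_permutations[of "{..n}" "Suc n"] by (simp add: N_def mult_ac del: fact_Suc)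
    finally show ?thesis using N by (simp add: E_def pos_divide_le_eq mult.commute)
  qed
  moreover have "E (map ((\<circ>) k) gs) = E gs" if k: "k \<in> K" and gs: "gs \<in> tup n G" for k gs
  proof -
    have "prism f (q (map ((\<circ>) k) gs) (map (\<lambda>j. z \<omega> (\<pi> j)) [0..<n]))
        = prism f (q gs (map (\<lambda>j. z \<omega> (\<pi> j)) [0..<n]))" (is "prism f (q _ ?z) = _")
      if *: "\<omega> \<in> \<Omega>" "\<pi> permutes {..n}" for \<omega> \<pi>
    proof -
      \<comment> \<open>By equivariance of p, composing with k moves the bottom and the top of the
        prism simultaneously.\<close>
      have "q (map ((\<circ>) k) gs) ?z = map (map_prod ((\<circ>) k) ((\<circ>) k)) (q gs ?z)"
        using gs p(2) k
        by (intro nth_equalityI) (auto simp: q_def tup_def comp_assoc)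
      then have "prism f (q (map ((\<circ>) k) gs) ?z) = prism (\<lambda>zs. f (map ((\<circ>) k) zs)) (q gs ?z)"
        by (simp add: prism_map)
      also have "\<dots> = prism f (q gs ?z)"
      proof (rule prism_cong)
        fix ks assume "length ks = Suc (length (q gs ?z))"
          "set ks \<subseteq> set (map fst (q gs ?z)) \<union> set (map snd (q gs ?z))"
        then show "f (map ((\<circ>) k) ks) = f ks"
          using q_sub[OF gs zs[OF *]] gs
          by (intro inv[rule_format] k tupI) (auto simp: q_def tup_def)
      qed
      finally show ?thesis .
    qed
    then show ?thesis by (simp add: E_def)
  qed
  moreover have "\<bar>f gs + cob E gs - c\<bar> \<le> 2 * B / R"
    if gs: "gs \<in> tup (Suc n) G" and pS: "p ` set gs \<subseteq> S" for gs
  proof -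
    have "map p gs \<in> tup (Suc n) S" using gs pS by (auto simp: tup_def)
    moreover have "cob E gs = (\<Sum>\<omega>\<in>\<Omega>. \<Sum>\<pi> | \<pi> permutes {..n}.
             f (map2 (\<circ>) (map p gs) (map (\<lambda>j. z \<omega> (\<pi> j)) [0..<Suc n]))) / N - f gs"
      using averaged_homotopy[OF G K(2) p(1) cocycle \<Omega> z gs]
      unfolding E_def q_def N_def by simp
    ultimately show ?thesis using est by (simp add: N_def del: fact_Suc upt_Suc)
  qed
  ultimately show ?thesis using c by blast
qed

text \<open>The bounds being uniform, an ultralimit over finite S exhausting K and R tending to
  infinity yields \<open>f gs + cob E gs = c\<close> exactly. It remains to dispose of c.\<close>

theorem displaceable_cocycle_exact:
  fixes f :: "('a \<Rightarrow> 'a) list \<Rightarrow> real"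
  assumes G: "perm_group G" and K: "perm_group K" "K \<subseteq> G" and disp: "displaceable K"
    and f: "inv_cochain K G (Suc n) f" and n: "n \<ge> 1"
    and cocycle: "\<forall>gs\<in>tup (Suc (Suc n)) G. cob f gs = 0"
  shows "\<exists>E. inv_cochain K G n E \<and> (\<forall>gs\<in>tup (Suc n) G. cob E gs = f gs)"
proof -
  interpret G: perm_group G by fact
  obtain p where p: "\<forall>g\<in>G. p g \<in> K" "\<forall>k\<in>K. \<forall>g. p (k \<circ> g) = k \<circ> p g"
    using exists_equivariant_projection[OF G K] by blast
  obtain B where B: "\<forall>gs\<in>tup (Suc n) G. \<bar>f gs\<bar> \<le> B"
    and inv: "\<forall>k\<in>K. \<forall>gs\<in>tup (Suc n) G. f (map ((\<circ>) k) gs) = f gs"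
    using f by (auto simp: inv_cochain_def)
  define good where "good i Ec \<longleftrightarrow> \<bar>snd Ec\<bar> \<le> B \<and>
    (\<forall>gs\<in>tup n G. \<bar>fst Ec gs\<bar> \<le> n * B \<and> (\<forall>k\<in>K. fst Ec (map ((\<circ>) k) gs) = fst Ec gs)) \<and>
    (\<forall>gs\<in>tup (Suc n) G. p ` set gs \<subseteq> fst i \<longrightarrow>
       \<bar>f gs + cob (fst Ec) gs - snd Ec\<bar> \<le> 2 * B / real (Suc (snd i)))"
    for i :: "('a \<Rightarrow> 'a) set \<times> nat" and Ec :: "(('a \<Rightarrow> 'a) list \<Rightarrow> real) \<times> real"
  have ex: "\<exists>Ec. good i Ec" if "finite (fst i)" "fst i \<subseteq> K" for i
    using displaceable_approx[where n = n and f = f and B = B and R = "Suc (snd i)",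
        OF G K disp p cocycle inv B that]
    unfolding good_def by auto
  define F where "F = finite_subsets_at_top K \<times>\<^sub>F (sequentially)"
  have "F \<noteq> bot" by (simp add: F_def prod_filter_eq_bot finite_subsets_at_top_neq_bot)
  then obtain U where U: "U \<le> F" "ultra U" using exists_ultra_le by blast
  have evU: "eventually P U" if "eventually P F" for P
    using that U(1) by (rule filter_leD[rotated])
  have fin: "eventually (\<lambda>i. finite (fst i) \<and> fst i \<subseteq> K) U"
    using eventually_prod1[of sequentially "\<lambda>T. finite T \<and> T \<subseteq> K"] 
      eventually_finite_subsets_at_top_weakI[of K "\<lambda>T. finite T \<and> T \<subseteq> K"]
    by (intro evU) (simp add: F_def case_prod_unfold)
  define e where "e i = (SOME Ec. good i Ec)" for i
  have e: "eventually (\<lambda>i. good i (e i)) U"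
    by (rule eventually_mono[OF fin]) (use ex in \<open>auto simp: e_def intro: someI_ex\<close>)
  define E where "E gs = Lim U (\<lambda>i. fst (e i) gs)" for gs
  define c where "c = Lim U (\<lambda>i. snd (e i))"
  have lim_c: "((\<lambda>i. snd (e i)) \<longlongrightarrow> c) U"
    unfolding c_def by (rule ultra_tendsto_Lim[where B = B, OF U(2)], rule eventually_mono[OF e]) (simp add: good_def)
  have bd: "eventually (\<lambda>i. \<bar>fst (e i) gs\<bar> \<le> n * B) U" if "gs \<in> tup n G" for gs
    using that by (intro eventually_mono[OF e]) (simp add: good_def)
  have lim_E: "((\<lambda>i. fst (e i) gs) \<longlongrightarrow> E gs) U" if "gs \<in> tup n G" for gs
    unfolding E_def by (rule ultra_tendsto_Lim[OF U(2) bd[OF that]])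
  have E: "inv_cochain K G n E"
    unfolding inv_cochain_def
  proof (intro conjI ballI exI)
    fix gs assume gs: "gs \<in> tup n G"
    show "\<bar>E gs\<bar> \<le> n * B" unfolding E_def by (rule abs_Lim_le[OF U(2) bd[OF gs]])
    fix k assume "k \<in> K"
    then show "E (map ((\<circ>) k) gs) = E gs"
      unfolding E_def using gs by (intro Lim_cong[OF _ refl] eventually_mono[OF e]) (simp add: good_def)
  qed
  have fE: "f gs + cob E gs = c" if gs: "gs \<in> tup (Suc n) G" for gs
  proof -
    let ?d = "\<lambda>i. f gs + cob (fst (e i)) gs - snd (e i)"
    have "((\<lambda>i. cob (fst (e i)) gs) \<longlongrightarrow> cob E gs) U"
      using omit_tup[OF gs] gs by (intro tendsto_cob lim_E) (auto simp: tup_def)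
    then have "(?d \<longlongrightarrow> f gs + cob E gs - c) U"
      by (intro tendsto_intros lim_c)
    moreover have "(?d \<longlongrightarrow> 0) U"
    proof (rule Lim_null_comparison)
      have "eventually (\<lambda>i. p ` set gs \<subseteq> fst i) U"
      proof (rule evU)
        have "eventually (\<lambda>T. p ` set gs \<subseteq> T) (finite_subsets_at_top K)"
          unfolding eventually_finite_subsets_at_top
          by (intro exI[of _ "p ` set gs"]) (use gs p(1) in \<open>auto simp: tup_def\<close>)
        then show "eventually (\<lambda>i. p ` set gs \<subseteq> fst i) F"
          using eventually_prod1[of sequentially "\<lambda>T. p ` set gs \<subseteq> T"]
          by (simp add: F_def case_prod_unfold)
      qed
      then show "eventually (\<lambda>i. norm (?d i) \<le> 2 * B / real (Suc (snd i))) U"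
        using e by eventually_elim (use gs in \<open>simp add: good_def\<close>)
      have "filterlim snd sequentially U"
        using filterlim_snd[of sequentially "finite_subsets_at_top K"] U(1)
        unfolding F_def by (rule filterlim_mono[OF _ order_refl])
      moreover have "(\<lambda>k. 2 * B / real (Suc k)) \<longlonglongrightarrow> 0"
        using LIMSEQ_Suc[OF lim_const_over_n] by simp
      ultimately show "((\<lambda>i. 2 * B / real (Suc (snd i))) \<longlongrightarrow> 0) U"
        by (rule filterlim_compose[rotated])
    qed
    ultimately show ?thesis
      using tendsto_unique U(2) unfolding ultra_def by fastforce
  qed
  \<comment> \<open>On lists of length n + 1 a constant is its own coboundary when n is even. When n
    is odd, \<open>f + cob E\<close> is a cocycle, while the coboundary of c on lists of odd length
    n + 2 equals c; hence c = 0.\<close>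
  define c' where "c' = (if even n then c else 0)"
  have "c = 0" if "odd n"
  proof -
    let ?gs = "replicate (Suc (Suc n)) (id :: 'a \<Rightarrow> 'a)"
    have gs: "?gs \<in> tup (Suc (Suc n)) G" using G.id_mem by (auto simp: tup_def)
    have "cob (\<lambda>gs. f gs + cob E gs) ?gs = cob (\<lambda>_. c) ?gs"
      using omit_tup[OF gs] by (intro cob_cong fE) auto
    then show ?thesis using cocycle gs that by (simp only: cob_add cob_cob cob_const) simp
  qed
  moreover have "cob (\<lambda>gs. c' - E gs) gs = (if even n then c' else 0) - cob E gs"
    if "gs \<in> tup (Suc n) G" for gs
    using that by (simp add: cob_diff[of "\<lambda>_. c'"] cob_const tup_def)
  ultimately have "cob (\<lambda>gs. c' - E gs) gs = f gs" if "gs \<in> tup (Suc n) G" for gs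
    using fE[OF that] that by (auto simp: c'_def)
  moreover have "inv_cochain K G n (\<lambda>gs. c' - E gs)"
  proof -
    obtain C where "\<And>gs. gs \<in> tup n G \<Longrightarrow> \<bar>E gs\<bar> \<le> C" using E by (auto simp: inv_cochain_def)
    then have "\<bar>c' - E gs\<bar> \<le> \<bar>c'\<bar> + C" if "gs \<in> tup n G" for gs
      using that by (smt (verit))
    then show ?thesis using E by (auto simp: inv_cochain_def)
  qed
  ultimately show ?thesis by blast
qed

section \<open>Highly transitive actions with displaceable stabilizers\<close>

definition dtup :: "nat \<Rightarrow> 'a set \<Rightarrow> 'a list set" where
  "dtup n Y = {xs \<in> tup n Y. distinct xs}"

lemma omit_dtup: "xs \<in> dtup (Suc n) Y \<Longrightarrow> i < Suc n \<Longrightarrow> omit i xs \<in> dtup n Y"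
  by (simp add: dtup_def omit_tup distinct_omit)

lemma exists_dtup:
  assumes "infinite Y"
  shows "\<exists>xs. xs \<in> dtup n Y"
proof -
  obtain T where T: "finite T" "card T = n" "T \<subseteq> Y"
    using infinite_arbitrarily_large[OF assms] by blast
  then obtain xs where "set xs = T" "distinct xs" using finite_distinct_list by blast
  then show ?thesis using T distinct_card[of xs] by (auto simp: dtup_def tup_def)
qed

text \<open>The bidegree is given by the lengths a and q. The value q = 0 is included: it is the
  augmentation of the rows by cochains of G alone.\<close>

definition equi_cochain ::
    "('a \<Rightarrow> 'a) set \<Rightarrow> 'a set \<Rightarrow> nat \<Rightarrow> nat \<Rightarrow> (('a \<Rightarrow> 'a) list \<Rightarrow> 'a list \<Rightarrow> real) \<Rightarrow> bool" where
  "equi_cochain G Y a q F \<longleftrightarrow>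
     (\<forall>g\<in>G. \<forall>gs\<in>tup a G. \<forall>xs\<in>dtup q Y. F (map ((\<circ>) g) gs) (map g xs) = F gs xs) \<and>
     (\<exists>B. \<forall>gs\<in>tup a G. \<forall>xs\<in>dtup q Y. \<bar>F gs xs\<bar> \<le> B)"

lemma equi_cochain_diff:
  assumes "equi_cochain G Y a q F" "equi_cochain G Y a q F'"
  shows "equi_cochain G Y a q (\<lambda>gs xs. F gs xs - F' gs xs)"
proof -
  obtain B B' where "\<forall>gs\<in>tup a G. \<forall>xs\<in>dtup q Y. \<bar>F gs xs\<bar> \<le> B"
    "\<forall>gs\<in>tup a G. \<forall>xs\<in>dtup q Y. \<bar>F' gs xs\<bar> \<le> B'"
    using assms by (auto simp: equi_cochain_def)
  then have "\<forall>gs\<in>tup a G. \<forall>xs\<in>dtup q Y. \<bar>F gs xs - F' gs xs\<bar> \<le> B + B'" by fastforce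
  then show ?thesis using assms by (auto simp: equi_cochain_def)
qed

lemma equi_cochain_const: "equi_cochain G Y a q (\<lambda>_ _. c)"
  by (auto simp: equi_cochain_def)

lemma equi_cochain_cob_points:
  assumes "equi_cochain G Y a q F"
  shows "equi_cochain G Y a (Suc q) (\<lambda>gs. cob (F gs))"
proof -
  obtain B where B: "\<forall>gs\<in>tup a G. \<forall>xs\<in>dtup q Y. \<bar>F gs xs\<bar> \<le> B"
    using assms by (auto simp: equi_cochain_def)
  have "\<bar>cob (F gs) xs\<bar> \<le> Suc q * B" if "gs \<in> tup a G" "xs \<in> dtup (Suc q) Y" for gs xs
  proof -
    have "length xs = Suc q" using that by (simp add: dtup_def tup_def)
    then show ?thesis using abs_cob_le[of xs "F gs" B] B omit_dtup[OF that(2)] that(1) by simp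
  qed
  moreover have "cob (F (map ((\<circ>) g) gs)) (map g xs) = cob (F gs) xs"
    if "g \<in> G" "gs \<in> tup a G" "xs \<in> dtup (Suc q) Y" for g gs xs
  proof -
    have "length xs = Suc q" using that by (simp add: dtup_def tup_def)
    then show ?thesis
      using assms omit_dtup[OF that(3)] that(1,2) unfolding cob_map[symmetric]
      by (intro cob_cong) (simp add: equi_cochain_def)
  qed
  ultimately show ?thesis unfolding equi_cochain_def by blast
qed

lemma equi_cochain_cob_group:
  assumes "equi_cochain G Y a q F"
  shows "equi_cochain G Y (Suc a) q (\<lambda>gs xs. cob (\<lambda>gs. F gs xs) gs)"
proof -
  obtain B where B: "\<forall>gs\<in>tup a G. \<forall>xs\<in>dtup q Y. \<bar>F gs xs\<bar> \<le> B"
    using assms by (auto simp: equi_cochain_def)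
  have "\<bar>cob (\<lambda>gs. F gs xs) gs\<bar> \<le> Suc a * B" if "gs \<in> tup (Suc a) G" "xs \<in> dtup q Y" for gs xs
  proof -
    have "length gs = Suc a" using that by (simp add: tup_def)
    then show ?thesis using abs_cob_le[of gs "\<lambda>gs. F gs xs" B] B omit_tup[OF that(1)] that(2) by simp
  qed
  moreover have "cob (\<lambda>gs. F gs (map g xs)) (map ((\<circ>) g) gs) = cob (\<lambda>gs. F gs xs) gs"
    if "g \<in> G" "gs \<in> tup (Suc a) G" "xs \<in> dtup q Y" for g gs xs
  proof -
    have "length gs = Suc a" using that by (simp add: tup_def)
    then show ?thesis
      using assms omit_tup[OF that(2)] that(1,3) unfolding cob_map[of _ "(\<circ>) g", symmetric]
      by (intro cob_cong) (simp add: equi_cochain_def)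
  qed
  ultimately show ?thesis unfolding equi_cochain_def by blast
qed

text \<open>Stabilizers of nonempty tuples only: the empty tuple would demand displaceability of G
  itself.\<close>

locale highly_transitive = perm_group G for G :: "('a \<Rightarrow> 'a) set" +
  fixes Y :: "'a set"
  assumes infinite: "infinite Y"
    and act: "g \<in> G \<Longrightarrow> x \<in> Y \<Longrightarrow> g x \<in> Y"
    and transitive: "xs \<in> dtup q Y \<Longrightarrow> ys \<in> dtup q Y \<Longrightarrow> \<exists>g\<in>G. map g xs = ys"
    and displaceable_stabilizer:
      "xs \<in> dtup (Suc q) Y \<Longrightarrow> displaceable {g \<in> G. \<forall>x\<in>set xs. g x = x}"
begin

lemma inj_mem: "g \<in> G \<Longrightarrow> inj g"
  by (simp add: bij_mem bij_is_inj)

lemma map_dtup: "g \<in> G \<Longrightarrow> xs \<in> dtup q Y \<Longrightarrow> map g xs \<in> dtup q Y"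
  using act inj_on_subset[OF inj_mem, of g "set xs"] by (auto simp: dtup_def tup_def distinct_map)

lemma perm_group_stabilizer: "perm_group {g \<in> G. \<forall>x\<in>set xs. g x = x}"
proof
  fix g assume "g \<in> {g \<in> G. \<forall>x\<in>set xs. g x = x}"
  then show "finv g \<in> {g \<in> G. \<forall>x\<in>set xs. g x = x}"
    using inv_mem inj_mem by (auto intro: inv_f_eq)
qed (auto simp: id_mem comp_mem bij_mem)

text \<open>The homotopy inserts a new point, far out along an ultrafilter on \<open>Y\<close>; moving that point by the
  first group element \<open>hd gs\<close> makes the result equivariant.\<close>

lemma row_exact:
  assumes F: "equi_cochain G Y (Suc a) (Suc q) F"
    and closed: "\<forall>gs\<in>tup (Suc a) G. \<forall>xs\<in>dtup (Suc (Suc q)) Y. cob (F gs) xs = 0"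
  shows "\<exists>E. equi_cochain G Y (Suc a) q E \<and>
    (\<forall>gs\<in>tup (Suc a) G. \<forall>xs\<in>dtup (Suc q) Y. cob (E gs) xs = F gs xs)"
proof -
  let ?C = "inf cofinite (principal Y)"
  have "?C \<noteq> bot"
    using infinite by (simp add: trivial_limit_def eventually_inf_principal eventually_cofinite)
  then obtain U where U: "U \<le> ?C" "ultra U" using exists_ultra_le by blast
  obtain B where B: "\<forall>gs\<in>tup (Suc a) G. \<forall>xs\<in>dtup (Suc q) Y. \<bar>F gs xs\<bar> \<le> B"
    using F by (auto simp: equi_cochain_def)
  define E where "E gs xs = Lim U (\<lambda>y. F gs (hd gs y # xs))" for gs xs
  have hd: "hd gs \<in> G" if "gs \<in> tup (Suc a) G" for gs
    using that by (cases gs) (auto simp: tup_def)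
  \<comment> \<open>\<open>hd gs\<close> is injective, so it sends only finitely many y into xs, and
    the ultrafilter ignores finite sets.\<close>
  have generic: "eventually (\<lambda>y. hd gs y # xs \<in> dtup (Suc r) Y) U"
    if "gs \<in> tup (Suc a) G" "xs \<in> dtup r Y" for gs xs r
  proof (rule filter_leD[OF U(1)])
    have "finite (hd gs -` set xs)"
      by (rule finite_vimageI[OF finite_set inj_mem[OF hd[OF that(1)]]])
    then have "finite {y. \<not> (y \<in> Y \<longrightarrow> hd gs y # xs \<in> dtup (Suc r) Y)}"
      by (rule finite_subset[rotated])
        (use that(2) act[OF hd[OF that(1)]] in \<open>auto simp: dtup_def tup_def\<close>)
    then show "eventually (\<lambda>y. hd gs y # xs \<in> dtup (Suc r) Y) ?C"
      by (simp add: eventually_inf_principal eventually_cofinite)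
  qed
  have bd: "eventually (\<lambda>y. \<bar>F gs (hd gs y # xs)\<bar> \<le> B) U"
    if "gs \<in> tup (Suc a) G" "xs \<in> dtup q Y" for gs xs
    by (rule eventually_mono[OF generic[OF that]]) (use B that in auto)
  have lim: "((\<lambda>y. F gs (hd gs y # xs)) \<longlongrightarrow> E gs xs) U"
    if "gs \<in> tup (Suc a) G" "xs \<in> dtup q Y" for gs xs
    unfolding E_def by (rule ultra_tendsto_Lim[OF U(2) bd[OF that]])
  have "cob (E gs) xs = F gs xs" if gs: "gs \<in> tup (Suc a) G" and xs: "xs \<in> dtup (Suc q) Y" for gs xs
  proof -
    have "length xs = Suc q" using xs by (simp add: dtup_def tup_def)
    then have "((\<lambda>y. cob (\<lambda>ys. F gs (hd gs y # ys)) xs) \<longlongrightarrow> cob (E gs) xs) U"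
      using omit_dtup[OF xs] gs by (intro tendsto_cob lim) auto
    \<comment> \<open>Closedness on the list with the new point in front, expanded by
      \<open>cob_Cons\<close>, isolates \<open>F gs xs\<close>: inserting a point contracts the
      row.\<close>
    moreover have "eventually (\<lambda>y. cob (\<lambda>ys. F gs (hd gs y # ys)) xs = F gs xs) U"
    proof (rule eventually_mono[OF generic[OF gs xs]])
      fix y assume "hd gs y # xs \<in> dtup (Suc (Suc q)) Y"
      then have "cob (F gs) (hd gs y # xs) = 0" using closed gs by blast
      then show "cob (\<lambda>ys. F gs (hd gs y # ys)) xs = F gs xs" by (simp add: cob_Cons)
    qed
    ultimately have "((\<lambda>y. F gs xs) \<longlongrightarrow> cob (E gs) xs) U"
      by (rule tendsto_cong[THEN iffD1, rotated])
    then show ?thesis using U(2) by (auto simp: ultra_def tendsto_const_iff)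
  qed
  moreover have "equi_cochain G Y (Suc a) q E"
    unfolding equi_cochain_def
  proof (intro conjI ballI exI)
    fix gs xs assume gs: "gs \<in> tup (Suc a) G" and xs: "xs \<in> dtup q Y"
    show "\<bar>E gs xs\<bar> \<le> B" unfolding E_def by (rule abs_Lim_le[OF U(2) bd[OF gs xs]])
    fix g assume g: "g \<in> G"
    have hd_map: "hd (map ((\<circ>) g) gs) = g \<circ> hd gs" using gs by (cases gs) (auto simp: tup_def)
    have "eventually (\<lambda>y. F (map ((\<circ>) g) gs) (map g (hd gs y # xs)) = F gs (hd gs y # xs)) U"
      by (rule eventually_mono[OF generic[OF gs xs]])
        (use F g gs in \<open>unfold equi_cochain_def, blast\<close>)
    then show "E (map ((\<circ>) g) gs) (map g xs) = E gs xs"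
      unfolding E_def hd_map by (intro Lim_cong[OF _ refl]) simp
  qed
  ultimately show ?thesis by blast
qed

text \<open>The cochains on \<open>G\<^sup>n \<times> Y\<^sup>q\<close> that are equivariant under \<open>G\<close> are the cochains on \<open>G\<^sup>n\<close> that are
  invariant under the stabilizer of one tuple of points.\<close>

lemma column_exact:
  assumes F: "equi_cochain G Y (Suc n) (Suc q) F" and n: "n \<ge> 1"
    and closed: "\<forall>gs\<in>tup (Suc (Suc n)) G. \<forall>xs\<in>dtup (Suc q) Y. cob (\<lambda>gs. F gs xs) gs = 0"
  shows "\<exists>E. equi_cochain G Y n (Suc q) E \<and>
    (\<forall>gs\<in>tup (Suc n) G. \<forall>xs\<in>dtup (Suc q) Y. cob (\<lambda>gs. E gs xs) gs = F gs xs)"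
proof -
  obtain xs\<^sub>0 where xs0: "xs\<^sub>0 \<in> dtup (Suc q) Y" using exists_dtup[OF infinite] by blast
  define K where "K = {g \<in> G. \<forall>x\<in>set xs\<^sub>0. g x = x}"
  have "inv_cochain K G (Suc n) (\<lambda>gs. F gs xs\<^sub>0)"
  proof -
    have "F (map ((\<circ>) k) gs) xs\<^sub>0 = F gs xs\<^sub>0" if "k \<in> K" "gs \<in> tup (Suc n) G" for k gs
    proof -
      have "map k xs\<^sub>0 = xs\<^sub>0" using that(1) by (simp add: K_def map_idI)
      then show ?thesis using F that xs0 unfolding equi_cochain_def K_def by (metis (no_types, lifting) mem_Collect_eq)
    qed
    then show ?thesis using F xs0 unfolding inv_cochain_def equi_cochain_def by blast
  qed
  then obtain e where e: "inv_cochain K G n e" and ecob: "\<forall>gs\<in>tup (Suc n) G. cob e gs = F gs xs\<^sub>0"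
    using displaceable_cocycle_exact[of G K n "\<lambda>gs. F gs xs\<^sub>0"] perm_group_axioms
      perm_group_stabilizer[of xs\<^sub>0] displaceable_stabilizer[OF xs0] n closed xs0
    by (auto simp: K_def)
  define \<gamma> where "\<gamma> xs = (SOME g. g \<in> G \<and> map g xs = xs\<^sub>0)" for xs
  have \<gamma>: "\<gamma> xs \<in> G" "map (\<gamma> xs) xs = xs\<^sub>0" if "xs \<in> dtup (Suc q) Y" for xs
    using someI_ex[of "\<lambda>g. g \<in> G \<and> map g xs = xs\<^sub>0"] transitive[OF that xs0]
    unfolding \<gamma>_def by blast+
  define E where "E gs xs = e (map ((\<circ>) (\<gamma> xs)) gs)" for gs xs
  have "equi_cochain G Y n (Suc q) E"
  proof -
    obtain B where "\<forall>gs\<in>tup n G. \<bar>e gs\<bar> \<le> B" using e by (auto simp: inv_cochain_def)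
    then have "\<bar>E gs xs\<bar> \<le> B" if "gs \<in> tup n G" "xs \<in> dtup (Suc q) Y" for gs xs
      using map_comp_tup[OF \<gamma>(1)] that by (simp add: E_def)
    moreover have "E (map ((\<circ>) g) gs) (map g xs) = E gs xs"
      if g: "g \<in> G" and gs: "gs \<in> tup n G" and xs: "xs \<in> dtup (Suc q) Y" for g gs xs
    proof -
      note \<gamma>' = \<gamma>[OF map_dtup[OF g xs]]
      \<comment> \<open>\<open>?k\<close> compares two ways of carrying xs to the base tuple. It
        fixes the base tuple, so the invariance of e under K absorbs it.\<close>
      let ?k = "\<gamma> (map g xs) \<circ> g \<circ> finv (\<gamma> xs)"
      have "finv (\<gamma> xs) (\<gamma> xs x) = x" for x
        using inj_mem[OF \<gamma>(1)[OF xs]] by simp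
      then have "map ?k (map (\<gamma> xs) xs) = map (\<gamma> (map g xs)) (map g xs)" by simp
      then have "map ?k xs\<^sub>0 = xs\<^sub>0" using \<gamma>(2)[OF xs] \<gamma>'(2) by simp
      then have "?k \<in> K"
        using g \<gamma>(1)[OF xs] \<gamma>'(1) comp_mem inv_mem map_eq_conv[of ?k xs\<^sub>0 id]
        unfolding K_def by simp
      moreover have "map ((\<circ>) (\<gamma> (map g xs))) (map ((\<circ>) g) gs) = map ((\<circ>) ?k) (map ((\<circ>) (\<gamma> xs)) gs)"
        using comp_inv(2)[OF \<gamma>(1)[OF xs]] by (simp add: fun_eq_iff)
      moreover have "map ((\<circ>) (\<gamma> xs)) gs \<in> tup n G" by (rule map_comp_tup[OF \<gamma>(1)[OF xs] gs])
      ultimately show ?thesis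
        unfolding E_def using e[unfolded inv_cochain_def] by (simp only:)
    qed
    ultimately show ?thesis unfolding equi_cochain_def by blast
  qed
  moreover have "cob (\<lambda>gs. E gs xs) gs = F gs xs"
    if gs: "gs \<in> tup (Suc n) G" and xs: "xs \<in> dtup (Suc q) Y" for gs xs
  proof -
    have "cob (\<lambda>gs. E gs xs) gs = F (map ((\<circ>) (\<gamma> xs)) gs) xs\<^sub>0"
      unfolding E_def cob_map using ecob map_comp_tup[OF \<gamma>(1)[OF xs] gs] by simp
    also have "\<dots> = F gs xs"
      using F gs xs \<gamma>[OF xs] unfolding equi_cochain_def by metis
    finally show ?thesis .
  qed
  ultimately show ?thesis by blast
qed

section \<open>The staircase in the double complex\<close>

text \<open>Closedness on \<open>[id, g]\<close> removes the dependence on the group element;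
  equivariance and transitivity then remove the dependence on the points.\<close>

lemma equi_cochain_degree_0:
  assumes F: "equi_cochain G Y 1 q F"
    and closed: "\<forall>gs\<in>tup 2 G. \<forall>xs\<in>dtup q Y. cob (\<lambda>gs. F gs xs) gs = 0"
  shows "\<exists>c. \<forall>gs\<in>tup 1 G. \<forall>xs\<in>dtup q Y. F gs xs = c"
proof -
  obtain xs\<^sub>0 where xs0: "xs\<^sub>0 \<in> dtup q Y" using exists_dtup[OF infinite] by blast
  have indep: "F [g] xs = F [id] xs" if "g \<in> G" "xs \<in> dtup q Y" for g xs
    using closed[rule_format, of "[id, g]" xs] that id_mem by (simp add: tup_def cob_Cons)
  have "F gs xs = F [id] xs\<^sub>0" if gs: "gs \<in> tup 1 G" and xs: "xs \<in> dtup q Y" for gs xs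
  proof -
    obtain g where g: "g \<in> G" "gs = [g]" using gs by (auto simp: tup_def length_Suc_conv)
    obtain h where h: "h \<in> G" "map h xs = xs\<^sub>0" using transitive[OF xs xs0] by blast
    have "F gs xs = F [h \<circ> g] xs\<^sub>0"
      using F gs xs h g unfolding equi_cochain_def by force
    then show ?thesis using indep[OF comp_mem[OF h(1) g(1)] xs0] by simp
  qed
  then show ?thesis by blast
qed

text \<open>A primitive E in the group direction need not be closed in the point direction. Its
  defect \<open>cob (E gs)\<close> is again closed in both directions, with one group element less
  and one point more, so induction on n for all q gives a primitive D of the defect. A primitive C
  of D in the point direction then corrects E.\<close>

lemma bicocycle_exact:
  assumes "n \<ge> 1" "equi_cochain G Y (Suc n) (Suc q) F"
    and "\<forall>gs\<in>tup (Suc (Suc n)) G. \<forall>xs\<in>dtup (Suc q) Y. cob (\<lambda>gs. F gs xs) gs = 0"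
    and "\<forall>gs\<in>tup (Suc n) G. \<forall>xs\<in>dtup (Suc (Suc q)) Y. cob (F gs) xs = 0"
  shows "\<exists>E. equi_cochain G Y n (Suc q) E \<and>
    (\<forall>gs\<in>tup (Suc n) G. \<forall>xs\<in>dtup (Suc q) Y. cob (\<lambda>gs. E gs xs) gs = F gs xs) \<and>
    (\<forall>gs\<in>tup n G. \<forall>xs\<in>dtup (Suc (Suc q)) Y. cob (E gs) xs = 0)"
  using assms
proof (induction n arbitrary: q F rule: nat_induct_at_least)
  case base
  then have "\<exists>E. equi_cochain G Y 1 (Suc q) E \<and>
    (\<forall>gs\<in>tup (Suc 1) G. \<forall>xs\<in>dtup (Suc q) Y. cob (\<lambda>gs. E gs xs) gs = F gs xs)"
    by (intro column_exact) auto
  then obtain E where E: "equi_cochain G Y 1 (Suc q) E"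
    and EF: "\<forall>gs\<in>tup (Suc 1) G. \<forall>xs\<in>dtup (Suc q) Y. cob (\<lambda>gs. E gs xs) gs = F gs xs"
    by blast
  have len: "length xs = r" if "xs \<in> dtup r Y" for xs r using that by (simp add: dtup_def tup_def)
  have "\<forall>gs\<in>tup 2 G. \<forall>xs\<in>dtup (Suc (Suc q)) Y. cob (\<lambda>gs. cob (E gs) xs) gs = 0"
  proof (intro ballI)
    fix gs xs assume gs: "gs \<in> tup 2 G" and xs: "xs \<in> dtup (Suc (Suc q)) Y"
    have "cob (\<lambda>gs. cob (E gs) xs) gs = cob (\<lambda>xs. cob (\<lambda>gs. E gs xs) gs) xs"
      by (rule cob_commute)
    also have "\<dots> = cob (F gs) xs"
      using gs omit_dtup[OF xs] EF
      by (intro cob_cong) (simp add: len[OF xs] numeral_2_eq_2)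
    also have "\<dots> = 0" using base(3) gs xs by (simp add: numeral_2_eq_2)
    finally show "cob (\<lambda>gs. cob (E gs) xs) gs = 0" .
  qed
  then obtain c where c: "\<forall>gs\<in>tup 1 G. \<forall>xs\<in>dtup (Suc (Suc q)) Y. cob (E gs) xs = c"
    using equi_cochain_degree_0[OF equi_cochain_cob_points[OF E]] by blast
  \<comment> \<open>For odd q a list of q + 2 points has odd length, and subtracting c from E
    removes the constant. For even q the constant is 0, because \<open>cob (cob (E [id]))\<close>
    vanishes on q + 3 points.\<close>
  define c' where "c' = (if odd q then c else 0)"
  have c0: "c = 0" if "even q"
  proof -
    obtain xs where xs: "xs \<in> dtup (Suc (Suc (Suc q))) Y" using exists_dtup[OF infinite] by blast
    have id: "[id] \<in> tup 1 G" using id_mem by (simp add: tup_def)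
    have "cob (cob (E [id])) xs = cob (\<lambda>_. c) xs"
      using c id omit_dtup[OF xs] by (intro cob_cong) (simp add: len[OF xs])
    then show ?thesis using that by (simp add: cob_cob cob_const len[OF xs])
  qed
  show ?case
  proof (intro exI[of _ "\<lambda>gs xs. E gs xs - c'"] conjI ballI)
    show "equi_cochain G Y 1 (Suc q) (\<lambda>gs xs. E gs xs - c')"
      by (intro equi_cochain_diff E equi_cochain_const)
    fix gs xs assume "gs \<in> tup (Suc 1) G" "xs \<in> dtup (Suc q) Y"
    then show "cob (\<lambda>gs. E gs xs - c') gs = F gs xs"
      using EF by (simp add: cob_diff cob_const tup_def)
  next
    fix gs xs assume "gs \<in> tup 1 G" "xs \<in> dtup (Suc (Suc q)) Y"
    then show "cob (\<lambda>xs. E gs xs - c') xs = 0"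
      using c c0 len by (auto simp: cob_diff cob_const c'_def)
  qed
next
  case (Suc n)
  have len: "length xs = r" if "xs \<in> dtup r Y" for xs r using that by (simp add: dtup_def tup_def)
  have leng: "length gs = r" if "gs \<in> tup r G" for gs r using that by (simp add: tup_def)
  have "\<exists>E. equi_cochain G Y (Suc n) (Suc q) E \<and>
    (\<forall>gs\<in>tup (Suc (Suc n)) G. \<forall>xs\<in>dtup (Suc q) Y. cob (\<lambda>gs. E gs xs) gs = F gs xs)"
    using Suc.prems by (intro column_exact) auto
  then obtain E where E: "equi_cochain G Y (Suc n) (Suc q) E"
    and EF: "\<forall>gs\<in>tup (Suc (Suc n)) G. \<forall>xs\<in>dtup (Suc q) Y. cob (\<lambda>gs. E gs xs) gs = F gs xs"
    by blast
  have "\<forall>gs\<in>tup (Suc (Suc n)) G. \<forall>xs\<in>dtup (Suc (Suc q)) Y. cob (\<lambda>gs. cob (E gs) xs) gs = 0"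
  proof (intro ballI)
    fix gs xs assume gs: "gs \<in> tup (Suc (Suc n)) G" and xs: "xs \<in> dtup (Suc (Suc q)) Y"
    have "cob (\<lambda>gs. cob (E gs) xs) gs = cob (\<lambda>xs. cob (\<lambda>gs. E gs xs) gs) xs"
      by (rule cob_commute)
    also have "\<dots> = cob (F gs) xs"
      using gs omit_dtup[OF xs] EF
      by (intro cob_cong) (simp add: len[OF xs])
    also have "\<dots> = 0" using Suc.prems(3) gs xs by simp
    finally show "cob (\<lambda>gs. cob (E gs) xs) gs = 0" .
  qed
  then obtain D where D: "equi_cochain G Y n (Suc (Suc q)) D"
    "\<forall>gs\<in>tup (Suc n) G. \<forall>xs\<in>dtup (Suc (Suc q)) Y. cob (\<lambda>gs. D gs xs) gs = cob (E gs) xs"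
    "\<forall>gs\<in>tup n G. \<forall>xs\<in>dtup (Suc (Suc (Suc q))) Y. cob (D gs) xs = 0"
    using Suc.IH[OF equi_cochain_cob_points[OF E]] by (auto simp: cob_cob)
  obtain m where m: "n = Suc m" using Suc.hyps by (cases n) auto
  obtain C where C: "equi_cochain G Y n (Suc q) C"
    "\<forall>gs\<in>tup n G. \<forall>xs\<in>dtup (Suc (Suc q)) Y. cob (C gs) xs = D gs xs"
    using row_exact[of m "Suc q" D] D(1,3) unfolding m by blast
  let ?E = "\<lambda>gs xs. E gs xs - cob (\<lambda>gs. C gs xs) gs"
  show ?case
  proof (intro exI[of _ ?E] conjI ballI)
    show "equi_cochain G Y (Suc n) (Suc q) ?E"
      by (intro equi_cochain_diff E equi_cochain_cob_group C)
    fix gs xs assume "gs \<in> tup (Suc (Suc n)) G" "xs \<in> dtup (Suc q) Y"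
    then show "cob (\<lambda>gs. ?E gs xs) gs = F gs xs"
      using EF by (simp add: cob_diff cob_cob)
  next
    fix gs xs assume gs: "gs \<in> tup (Suc n) G" and xs: "xs \<in> dtup (Suc (Suc q)) Y"
    have "cob (\<lambda>xs. cob (\<lambda>gs. C gs xs) gs) xs = cob (\<lambda>gs. cob (C gs) xs) gs"
      by (rule cob_commute[symmetric])
    also have "\<dots> = cob (\<lambda>gs. D gs xs) gs"
      using C(2) omit_tup[OF gs] xs by (intro cob_cong) (simp add: leng[OF gs])
    also have "\<dots> = cob (E gs) xs" using D(2) gs xs by simp
    finally show "cob (?E gs) xs = 0" by (simp add: cob_diff)
  qed
qed

text \<open>Read as constant in one point, f is closed in both directions. The primitive F so
  obtained is closed in the point direction, hence comes from the empty list of points, that is,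
  from a cochain of G alone.\<close>

theorem cocycle_exact:
  assumes f: "inv_cochain G G (Suc n) f" and n: "n \<ge> 1"
    and closed: "\<forall>gs\<in>tup (Suc (Suc n)) G. cob f gs = 0"
  shows "\<exists>e. inv_cochain G G n e \<and> (\<forall>gs\<in>tup (Suc n) G. cob e gs = f gs)"
proof -
  have "equi_cochain G Y (Suc n) (Suc 0) (\<lambda>gs _. f gs)"
    using f by (auto simp: equi_cochain_def inv_cochain_def)
  then obtain F where F: "equi_cochain G Y n (Suc 0) F"
    "\<forall>gs\<in>tup (Suc n) G. \<forall>xs\<in>dtup (Suc 0) Y. cob (\<lambda>gs. F gs xs) gs = f gs"
    "\<forall>gs\<in>tup n G. \<forall>xs\<in>dtup (Suc (Suc 0)) Y. cob (F gs) xs = 0"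
    using bicocycle_exact[of n 0 "\<lambda>gs _. f gs"] n closed
    by (auto simp: cob_const dtup_def tup_def)
  obtain m where m: "n = Suc m" using n by (cases n) auto
  obtain E where E: "equi_cochain G Y n 0 E"
    "\<forall>gs\<in>tup n G. \<forall>xs\<in>dtup (Suc 0) Y. cob (E gs) xs = F gs xs"
    using row_exact[of m 0 F] F(1,3) unfolding m by blast
  obtain x where x: "x \<in> Y" using infinite_imp_nonempty[OF infinite] by blast
  have x1: "[x] \<in> dtup (Suc 0) Y" and nil: "[] \<in> dtup 0 Y" using x by (auto simp: dtup_def tup_def)
  have EF: "E gs [] = F gs [x]" if "gs \<in> tup n G" for gs
  proof -
    have "cob (E gs) [x] = F gs [x]" using E(2) that x1 by blast
    then show ?thesis by (simp add: cob_Cons)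
  qed
  have "inv_cochain G G n (\<lambda>gs. E gs [])"
    using E(1) nil unfolding inv_cochain_def equi_cochain_def by fastforce
  moreover have "cob (\<lambda>gs. E gs []) gs = f gs" if gs: "gs \<in> tup (Suc n) G" for gs
  proof -
    have "cob (\<lambda>gs. E gs []) gs = cob (\<lambda>gs. F gs [x]) gs"
      using EF omit_tup[OF gs] gs by (intro cob_cong) (auto simp: tup_def)
    then show ?thesis using F(2) gs x1 by simp
  qed
  ultimately show ?thesis by blast
qed

end

section \<open>Local description of Thompson's group V\<close>

definition conc :: "bool list \<Rightarrow> (nat \<Rightarrow> bool) \<Rightarrow> nat \<Rightarrow> bool" where
  "conc r z = (\<lambda>k. if k < length r then r ! k else z (k - length r))"

definition shift :: "nat \<Rightarrow> (nat \<Rightarrow> bool) \<Rightarrow> nat \<Rightarrow> bool" where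
  "shift N z = (\<lambda>k. z (N + k))"

definition pre :: "nat \<Rightarrow> (nat \<Rightarrow> bool) \<Rightarrow> bool list" where
  "pre N x = map x [0..<N]"

definition agree :: "nat \<Rightarrow> (nat \<Rightarrow> bool) \<Rightarrow> (nat \<Rightarrow> bool) \<Rightarrow> bool" where
  "agree N x y \<longleftrightarrow> (\<forall>k<N. x k = y k)"

lemma length_pre [simp]: "length (pre N x) = N"
  by (simp add: pre_def)

lemma agree_refl [simp]: "agree N x x"
  by (simp add: agree_def)

lemma agree_sym: "agree N x y \<Longrightarrow> agree N y x"
  by (simp add: agree_def)

lemma agree_trans: "agree N x y \<Longrightarrow> agree N y z \<Longrightarrow> agree N x z"
  by (simp add: agree_def)

lemma agree_mono: "agree N x y \<Longrightarrow> M \<le> N \<Longrightarrow> agree M x y"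
  by (simp add: agree_def)

lemma shift_conc [simp]: "shift (length r) (conc r z) = z"
  by (simp add: shift_def conc_def)

lemma shift_conc_le: "N \<le> length r \<Longrightarrow> shift N (conc r z) = conc (drop N r) z"
  by (auto simp: shift_def conc_def fun_eq_iff add.commute)

lemma shift_shift [simp]: "shift N (shift M x) = shift (M + N) x"
  by (simp add: shift_def add.assoc)

lemma conc_append: "conc (r @ s) z = conc r (conc s z)"
  by (auto simp: conc_def fun_eq_iff nth_append)

lemma conc_Nil [simp]: "conc [] z = z"
  by (simp add: conc_def)

lemma shift_0 [simp]: "shift 0 z = z"
  by (simp add: shift_def)

lemma agree_conc_pre: "agree N x (conc (pre N x) z)"
  by (simp add: agree_def conc_def pre_def)

lemma agree_conc: "agree (length s) (conc s y) (conc s z)"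
  by (simp add: agree_def conc_def)

lemma conc_pre_shift: "agree N x y \<Longrightarrow> conc (pre N x) (shift N y) = y"
  by (auto simp: agree_def conc_def pre_def shift_def fun_eq_iff)

lemma conc_of_agree: "agree (length s) (conc s z) y \<Longrightarrow> conc s (shift (length s) y) = y"
  by (auto simp: agree_def conc_def shift_def fun_eq_iff)

lemma inj_conc: "conc s y = conc s z \<longleftrightarrow> y = z"
  by (metis shift_conc)

section \<open>Local prefix replacements\<close>

text \<open>Near x the first N symbols are exchanged for s. Since the condition is local, products
  and inverses avoid common refinements of partitions; compactness restores the finite partition
  afterwards.\<close>

definition locpre :: "((nat \<Rightarrow> bool) \<Rightarrow> nat \<Rightarrow> bool) \<Rightarrow> (nat \<Rightarrow> bool) \<Rightarrow> bool" where
  "locpre g x \<longleftrightarrow> (\<exists>N s. \<forall>y. agree N x y \<longrightarrow> g y = conc s (shift N y))"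

lemma locpreI: "(\<And>y. agree N x y \<Longrightarrow> g y = conc s (shift N y)) \<Longrightarrow> locpre g x"
  by (auto simp: locpre_def)

text \<open>The next L symbols of x are appended to the prefix on both sides, so a local description
  can be taken as deep as required.\<close>

lemma locpre_deep:
  assumes "locpre g x"
  obtains N s where "N \<ge> L" "length s \<ge> L" "\<And>y. agree N x y \<Longrightarrow> g y = conc s (shift N y)"
proof -
  obtain N s where Ns: "\<And>y. agree N x y \<Longrightarrow> g y = conc s (shift N y)"
    using assms by (auto simp: locpre_def)
  let ?t = "pre L (shift N x)"
  have "g y = conc (s @ ?t) (shift (N + L) y)" if "agree (N + L) x y" for y
  proof -
    have "agree L (shift N x) (shift N y)" using that by (auto simp: agree_def shift_def)
    then have "conc ?t (shift (N + L) y) = shift N y" using conc_pre_shift[of L "shift N x" "shift N y"] by simp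
    then show ?thesis using Ns[of y] that agree_mono[of "N + L" x y N] by (simp add: conc_append)
  qed
  then show ?thesis by (intro that[of "N + L" "s @ ?t"]) auto
qed

lemma locpre_comp:
  assumes "locpre g x" "locpre h (g x)"
  shows "locpre (h \<circ> g) x"
proof -
  obtain M t where t: "\<And>y. agree M (g x) y \<Longrightarrow> h y = conc t (shift M y)"
    using assms(2) by (auto simp: locpre_def)
  \<comment> \<open>With s at least as long as M, the image of the small cylinder lies in the
    cylinder on which h is known.\<close>
  obtain N s where s: "length s \<ge> M" "\<And>y. agree N x y \<Longrightarrow> g y = conc s (shift N y)"
    using locpre_deep[OF assms(1), of M] by metis
  show ?thesis
  proof (rule locpreI)
    fix y assume y: "agree N x y"
    have "agree M (g x) (g y)"
      using s(1) s(2)[OF y] s(2)[of x] agree_conc[of s "shift N x" "shift N y"]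
      by (auto intro: agree_mono)
    then show "(h \<circ> g) y = conc (t @ drop M s) (shift N y)"
      using t[of "g y"] s(1) s(2)[OF y] by (simp add: conc_append shift_conc_le)
  qed
qed

lemma locpre_local:
  assumes "locpre g x" and "\<And>y. agree M x y \<Longrightarrow> h y = g y"
  shows "locpre h x"
proof -
  obtain N s where "N \<ge> M" "\<And>y. agree N x y \<Longrightarrow> g y = conc s (shift N y)"
    using locpre_deep[OF assms(1), of M] by metis
  then show ?thesis using assms(2) agree_mono by (intro locpreI[of N x h s]) metis
qed

lemma locpre_id: "locpre id x"
  by (rule locpreI[of 0 _ _ "[]"]) simp

lemma locpre_conc: "locpre (conc r) x"
  by (rule locpreI[of 0 _ _ r]) simp

lemma locpre_shift: "locpre (shift N) x"
  by (rule locpreI[of N _ _ "[]"]) simp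

text \<open>On the cylinder of s the inverse puts back the first N symbols of the preimage of
  y.\<close>

lemma locpre_inv:
  assumes "bij g" "\<And>x. locpre g x"
  shows "locpre (finv g) y"
proof -
  let ?x = "finv g y"
  have gx: "g ?x = y" using assms(1) by (simp add: bij_is_surj surj_f_inv_f)
  obtain N s where s: "\<And>z. agree N ?x z \<Longrightarrow> g z = conc s (shift N z)"
    using assms(2)[of ?x] unfolding locpre_def by blast
  have y: "y = conc s (shift N ?x)" using s[of ?x] gx by simp
  show ?thesis
  proof (rule locpreI[of "length s" _ _ "pre N ?x"])
    fix z assume z: "agree (length s) y z"
    let ?u = "conc (pre N ?x) (shift (length s) z)"
    have "shift N ?u = shift (length s) z" using shift_conc[of "pre N ?x"] by simp
    then have "g ?u = conc s (shift (length s) z)" using s[OF agree_conc_pre] by simp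
    also have "\<dots> = z" by (rule conc_of_agree[of s "shift N ?x"]) (use z y in metis)
    finally show "finv g z = ?u" using assms(1) by (metis bij_inv_eq_iff)
  qed
qed

definition V_set :: "((nat \<Rightarrow> bool) \<Rightarrow> nat \<Rightarrow> bool) set" where
  "V_set = {g. bij g \<and> (\<forall>x. locpre g x)}"

lemma V_setI: "bij g \<Longrightarrow> (\<And>x. locpre g x) \<Longrightarrow> g \<in> V_set"
  unfolding V_set_def by blast

lemma V_set_bij: "g \<in> V_set \<Longrightarrow> bij g"
  unfolding V_set_def by blast

lemma V_set_locpre: "g \<in> V_set \<Longrightarrow> locpre g x"
  unfolding V_set_def by blast

interpretation V: perm_group V_set
proof
  show "id \<in> V_set" by (rule V_setI[OF bij_id locpre_id])
  show "g \<circ> h \<in> V_set" if "g \<in> V_set" "h \<in> V_set" for g h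
    by (rule V_setI[OF bij_comp[OF V_set_bij[OF that(2)] V_set_bij[OF that(1)]]
          locpre_comp[OF V_set_locpre[OF that(2)] V_set_locpre[OF that(1)]]])
  show "bij g" if "g \<in> V_set" for g by (rule V_set_bij[OF that])
  show "finv g \<in> V_set" if "g \<in> V_set" for g
    by (rule V_setI[OF bij_imp_bij_inv[OF V_set_bij[OF that]]
          locpre_inv[OF V_set_bij[OF that] V_set_locpre[OF that]]])
qed

section \<open>Compactness and the comparison with prefix exchanges\<close>

text \<open>Koenig's lemma: if no depth works uniformly, every bad word has a bad extension by one
  bit, and the infinite branch built this way contradicts the local hypothesis.\<close>

lemma cantor_uniform:
  assumes local: "\<And>x. \<exists>N. P (pre N x)"
    and mono: "\<And>M N x. P (pre M x) \<Longrightarrow> M \<le> N \<Longrightarrow> P (pre N x)"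
  shows "\<exists>N. \<forall>x. P (pre N x)"
proof (rule ccontr)
  assume contra: "\<nexists>N. \<forall>x. P (pre N x)"
  define bad where "bad r \<longleftrightarrow> (\<forall>N\<ge>length r. \<exists>x. \<not> P (pre N (conc r x)))" for r
  have step: "\<exists>b. bad (r @ [b])" if "bad r" for r
  proof (rule ccontr)
    assume "\<nexists>b. bad (r @ [b])"
    then have *: "\<exists>N\<ge>Suc (length r). \<forall>x. P (pre N (conc (r @ [b]) x))" for b
      by (simp add: bad_def)
    obtain N0 N1 where N: "N0 \<ge> Suc (length r)" "N1 \<ge> Suc (length r)"
      "\<And>x. P (pre N0 (conc (r @ [False]) x))" "\<And>x. P (pre N1 (conc (r @ [True]) x))"
      using *[of False] *[of True] by blast
    have "P (pre (max N0 N1) (conc r x))" for x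
    proof -
      have "conc r x = conc (r @ [x 0]) (shift 1 x)"
        by (auto simp: conc_def shift_def fun_eq_iff nth_append less_Suc_eq Suc_diff_Suc)
      then show ?thesis
        using mono[OF N(3), of "max N0 N1"] mono[OF N(4), of "max N0 N1"] by (cases "x 0") simp_all
    qed
    moreover have "length r \<le> max N0 N1" using N(1) by simp
    ultimately show False using that unfolding bad_def by blast
  qed
  have "bad []" using contra by (auto simp: bad_def)
  then obtain r where r: "\<And>n. bad (r n) \<and> length (r n) = n" "\<And>n. \<exists>b. r (Suc n) = r n @ [b]"
  proof -
    have "\<exists>r. \<forall>n. (bad (r n) \<and> length (r n) = n) \<and> (\<exists>b. r (Suc n) = r n @ [b])"
    proof (rule dependent_nat_choice)
      show "\<exists>r. bad r \<and> length r = 0" using \<open>bad []\<close> by (intro exI[of _ "[]"]) simp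
      fix r :: "bool list" and n assume r: "bad r \<and> length r = n"
      then obtain b where "bad (r @ [b])" using step by blast
      then show "\<exists>r'. (bad r' \<and> length r' = Suc n) \<and> (\<exists>b. r' = r @ [b])"
        using r by (intro exI[of _ "r @ [b]"]) simp
    qed
    then show ?thesis using that by blast
  qed
  define x where "x k = r (Suc k) ! k" for k
  have "r n = pre n x" for n
  proof (induction n)
    case 0 then show ?case using r(1)[of 0] by (simp add: pre_def)
  next
    case (Suc n)
    obtain b where b: "r (Suc n) = r n @ [b]" using r(2) by blast
    then have "x n = b" using r(1)[of n] by (simp add: x_def nth_append)
    then show ?case using b Suc by (simp add: pre_def)
  qed
  moreover obtain N where N: "P (pre N x)" using local by blast
  ultimately have "bad (pre N x)" using r(1)[of N] by simp
  then obtain z where "\<not> P (pre N (conc (pre N x) z))" unfolding bad_def by auto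
  moreover have "pre N (conc (pre N x) z) = pre N x"
    by (auto simp: pre_def conc_def)
  ultimately show False using N by simp
qed

lemma replace_prefix_eq: "replace_prefix r s x = conc s (shift (length r) x)"
  by (simp add: replace_prefix_def conc_def shift_def)

lemma cylinder_iff: "y \<in> cylinder r \<longleftrightarrow> conc r (shift (length r) y) = y"
  by (auto simp: cylinder_def conc_def shift_def fun_eq_iff)

lemma agree_cylinder: "x \<in> cylinder r \<Longrightarrow> agree (length r) x y \<Longrightarrow> y \<in> cylinder r"
  by (simp add: cylinder_def agree_def)

lemma conc_in_cylinder: "conc r z \<in> cylinder r"
  by (simp add: cylinder_def conc_def)

lemma prefix_exchange_locpre:
  assumes "prefix_exchange g"
  shows "locpre g x"
proof -
  obtain n :: nat and r s where cov: "(\<Union>i<n. cylinder (r i)) = UNIV"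
    and g: "\<forall>i<n. \<forall>x\<in>cylinder (r i). g x = replace_prefix (r i) (s i) x"
    using assms unfolding prefix_exchange_def by (elim exE conjE) (rule that)
  obtain i where i: "i < n" "x \<in> cylinder (r i)" using cov by blast
  show ?thesis
  proof (rule locpreI)
    fix y assume "agree (length (r i)) x y"
    then have "y \<in> cylinder (r i)" by (rule agree_cylinder[OF i(2)])
    then show "g y = conc (s i) (shift (length (r i)) y)"
      using g i(1) by (simp add: replace_prefix_eq)
  qed
qed

text \<open>Compactness gives one depth N for all points, and all words of length N serve as r. The
  cylinders of the words s are their images, so they inherit disjointness and covering from
  bijectivity of g.\<close>

lemma V_set_prefix_exchange:
  assumes "g \<in> V_set"
  shows "prefix_exchange g"
proof -
  have bij: "bij g" and loc: "\<And>x. locpre g x" using V_set_bij V_set_locpre assms by blast+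
  define P where "P r \<longleftrightarrow> (\<exists>s. \<forall>z. g (conc r z) = conc s z)" for r
  have "\<exists>N. \<forall>x. P (pre N x)"
  proof (rule cantor_uniform)
    fix x
    obtain N s where s: "\<And>y. agree N x y \<Longrightarrow> g y = conc s (shift N y)"
      using loc[of x] by (auto simp: locpre_def)
    have "g (conc (pre N x) z) = conc s z" for z
      using s[OF agree_conc_pre] shift_conc[of "pre N x" z] by simp
    then show "\<exists>N. P (pre N x)" unfolding P_def by blast
  next
    fix M N :: nat and x assume "P (pre M x)" "M \<le> N"
    then obtain s where s: "\<And>z. g (conc (pre M x) z) = conc s z" by (auto simp: P_def)
    have "pre N x = pre M x @ pre (N - M) (shift M x)"
      using \<open>M \<le> N\<close> by (intro nth_equalityI) (auto simp: pre_def shift_def nth_append)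
    then have "g (conc (pre N x) z) = conc (s @ pre (N - M) (shift M x)) z" for z
      by (simp add: conc_append s)
    then show "P (pre N x)" unfolding P_def by blast
  qed
  then obtain N where N: "\<And>x. P (pre N x)" by blast
  define W where "W = {r :: bool list. length r = N}"
  have "finite W" using finite_lists_length_eq[of "UNIV :: bool set" N] by (simp add: W_def)
  then obtain r where r: "bij_betw r {0..<card W} W" using ex_bij_betw_nat_finite by blast
  have len: "length (r i) = N" if "i < card W" for i
    using bij_betwE[OF r] that by (auto simp: W_def)
  have "\<exists>s. \<forall>z. g (conc (r i) z) = conc s z" if "i < card W" for i
  proof -
    have "r i = pre N (conc (r i) (\<lambda>_. False))"
      using len[OF that] by (intro nth_equalityI) (auto simp: pre_def conc_def)
    then show ?thesis using N[of "conc (r i) (\<lambda>_. False)"] unfolding P_def by metis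
  qed
  then obtain s where s: "\<And>i z. i < card W \<Longrightarrow> g (conc (r i) z) = conc (s i) z" by metis
  have disj: "i = j" if "i < card W" "j < card W" "y \<in> cylinder (r i)" "y \<in> cylinder (r j)" for i j y
  proof -
    have "r i = r j"
      using that(3,4) len[OF that(1)] len[OF that(2)] by (intro nth_equalityI) (auto simp: cylinder_def)
    then show ?thesis using bij_betw_imp_inj_on[OF r] that(1,2) by (simp add: inj_on_eq_iff)
  qed
  have cov: "\<exists>i<card W. y \<in> cylinder (r i)" for y
  proof -
    have "pre N y \<in> W" by (simp add: W_def)
    then obtain i where "i < card W" "r i = pre N y"
      using bij_betw_imp_surj_on[OF r] by (metis atLeastLessThan_iff imageE)
    then show ?thesis using conc_in_cylinder[of "pre N y" "shift N y"] conc_pre_shift[of N y y] by auto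
  qed
  have image: "y \<in> cylinder (s i) \<longleftrightarrow> finv g y \<in> cylinder (r i)" if "i < card W" for i y
  proof
    assume "y \<in> cylinder (s i)"
    then have "y = g (conc (r i) (shift (length (s i)) y))" using s[OF that] by (simp add: cylinder_iff)
    then have "finv g y = conc (r i) (shift (length (s i)) y)" using bij by (metis bij_inv_eq_iff)
    then show "finv g y \<in> cylinder (r i)" by (simp add: conc_in_cylinder)
  next
    assume "finv g y \<in> cylinder (r i)"
    then have "finv g y = conc (r i) (shift (length (r i)) (finv g y))" by (simp add: cylinder_iff)
    then have "y = conc (s i) (shift (length (r i)) (finv g y))"
      using s[OF that] bij by (metis bij_inv_eq_iff)
    then show "y \<in> cylinder (s i)" by (metis conc_in_cylinder)
  qed
  show ?thesis
    unfolding prefix_exchange_def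
  proof (intro exI conjI)
    show "disjoint_family_on (\<lambda>i. cylinder (r i)) {..<card W}"
      using disj by (auto simp: disjoint_family_on_def)
    show "(\<Union>i<card W. cylinder (r i)) = UNIV" using cov by auto
    show "disjoint_family_on (\<lambda>i. cylinder (s i)) {..<card W}"
      using disj image by (auto simp: disjoint_family_on_def)
    show "(\<Union>i<card W. cylinder (s i)) = UNIV" using cov image by blast
    show "\<forall>i<card W. \<forall>x\<in>cylinder (r i). g x = replace_prefix (r i) (s i) x"
    proof (intro allI impI ballI)
      fix i x assume "i < card W" "x \<in> cylinder (r i)"
      then show "g x = replace_prefix (r i) (s i) x"
        using s[of i "shift (length (r i)) x"] by (simp add: replace_prefix_eq cylinder_iff)
    qed
  qed
qed

lemma locpre_continuous:
  assumes "\<And>x. locpre g x"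
  shows "continuous_on UNIV g"
proof (rule continuous_on_coordinatewise_then_product)
  fix k
  show "continuous_on UNIV (\<lambda>x. g x k)"
    unfolding continuous_on_open_vimage[OF open_UNIV]
  proof (intro allI impI)
    fix B :: "bool set"
    have "\<exists>T. open T \<and> x \<in> T \<and> T \<subseteq> (\<lambda>x. g x k) -` B" if x: "g x k \<in> B" for x
    proof -
      \<comment> \<open>An output prefix longer than k fixes coordinate k of g on the whole
        cylinder.\<close>
      obtain N s where s: "length s \<ge> Suc k" "\<And>y. agree N x y \<Longrightarrow> g y = conc s (shift N y)"
        using locpre_deep[OF assms, of "Suc k" x] by metis
      have "{y. agree N x y} = (\<Inter>i\<in>{..<N}. (\<lambda>y. y i) -` {x i})"
        by (auto simp: agree_def)
      moreover have "open ((\<lambda>y :: nat \<Rightarrow> bool. y i) -` {x i})" for i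
        by (intro open_vimage open_discrete continuous_on_product_coordinates)
      ultimately have "open {y. agree N x y}" by (simp add: open_INT)
      moreover have "{y. agree N x y} \<subseteq> (\<lambda>x. g x k) -` B"
      proof
        fix y assume "y \<in> {y. agree N x y}"
        then have "g y k = g x k"
          using s(1) s(2)[of y] s(2)[of x] by (simp add: conc_def)
        with x show "y \<in> (\<lambda>x. g x k) -` B" by simp
      qed
      ultimately show ?thesis by (intro exI[of _ "{y. agree N x y}"]) simp
    qed
    then have "open ((\<lambda>x. g x k) -` B)" by (subst open_subopen) blast
    then show "open ((\<lambda>x. g x k) -` B \<inter> UNIV)" by simp
  qed
qed

lemma carrier_thompson_V: "carrier thompson_V = V_set"
proof -
  have "g \<in> V_set" if "homeomorphism UNIV UNIV g h" "prefix_exchange g" for g h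
  proof -
    have "bij g" using that(1) by (intro o_bij[of h]) (auto simp: homeomorphism_def)
    then show ?thesis using prefix_exchange_locpre[OF that(2)] by (intro V_setI)
  qed
  moreover have "homeomorphism UNIV UNIV g (finv g)" if "g \<in> V_set" for g
    using V_set_bij[OF that] locpre_continuous[OF V_set_locpre[OF that]]
      locpre_continuous[OF V_set_locpre[OF V.inv_mem[OF that]]]
    by (auto simp: homeomorphism_def bij_is_surj bij_is_inj surj_f_inv_f bij_imp_bij_inv)
  ultimately show ?thesis
    by (auto simp: thompson_V_def Homeo_def V_set_prefix_exchange)
qed

section \<open>The action on a tail equivalence class\<close>

text \<open>Any sequence that is not eventually periodic would do: an element of \<open>V\<close> that fixes such a point
  is the identity near it.\<close>

definition aperiodic :: "nat \<Rightarrow> bool" where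
  "aperiodic k \<longleftrightarrow> (\<exists>j. k = j * j)"

text \<open>The gaps between squares grow: for j at least d the number j^2 + d lies strictly between
  j^2 and (j + 1)^2.\<close>

lemma aperiodic_not_periodic:
  assumes "d \<ge> 1"
  shows "\<exists>k\<ge>N. aperiodic (k + d) \<noteq> aperiodic k"
proof (rule ccontr)
  assume "\<not> ?thesis"
  then have per: "\<And>k. k \<ge> N \<Longrightarrow> aperiodic (k + d) = aperiodic k" by blast
  define j where "j = max N d"
  have j: "N \<le> j" "d \<le> j" by (auto simp: j_def)
  have "aperiodic (j * j)" unfolding aperiodic_def by blast
  moreover have "N \<le> j * j" using j(1) le_trans[of N j "j * j"] by simp
  ultimately have "aperiodic (j * j + d)" using per by blast
  then obtain i where i: "j * j + d = i * i" by (auto simp: aperiodic_def)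
  have "\<not> i \<le> j"
  proof
    assume "i \<le> j"
    then have "i * i \<le> j * j" by (rule mult_le_mono[OF _ \<open>i \<le> j\<close>])
    then show False using i assms by simp
  qed
  then have "Suc j \<le> i" by simp
  then have "Suc j * Suc j \<le> i * i" by (rule mult_le_mono[OF _ \<open>Suc j \<le> i\<close>])
  then show False using i j by simp
qed

definition tails :: "(nat \<Rightarrow> bool) set" where
  "tails = {x. \<exists>a b. shift a x = shift b aperiodic}"

text \<open>Two equal shifts would make x eventually periodic with period n - m, and the indicator
  of the squares would inherit this period through the common tail.\<close>

lemma tails_aperiodic:
  assumes "x \<in> tails" "shift M x = shift N x"
  shows "M = N"
proof (rule ccontr)
  assume "M \<noteq> N"
  then obtain m n where mn: "m < n" "shift m x = shift n x"
    using assms(2) by (metis linorder_neqE_nat)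
  obtain a b where ab: "shift a x = shift b aperiodic" using assms(1) by (auto simp: tails_def)
  have x: "x (m + k) = x (n + k)" for k using fun_cong[OF mn(2), of k] by (simp add: shift_def)
  have xa: "x (a + k) = aperiodic (b + k)" for k using fun_cong[OF ab, of k] by (simp add: shift_def)
  have "aperiodic (k + (n - m)) = aperiodic k" if "k \<ge> b + m" for k
  proof -
    have "aperiodic (k + (n - m)) = x (n + (a + k - b - m))"
      using xa[of "k - b + (n - m)"] that mn(1) by (simp add: algebra_simps)
    also have "\<dots> = x (m + (a + k - b - m))" by (rule x[symmetric])
    also have "\<dots> = aperiodic k" using xa[of "k - b"] that by (simp add: algebra_simps)
    finally show ?thesis .
  qed
  moreover have "n - m \<ge> 1" using mn(1) by simp
  ultimately show False using aperiodic_not_periodic by blast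
qed

lemma infinite_tails: "infinite tails"
proof -
  have ap: "aperiodic \<in> tails" unfolding tails_def by blast
  have "inj (\<lambda>i. shift i aperiodic)" by (rule injI) (rule tails_aperiodic[OF ap])
  then have "infinite (range (\<lambda>i. shift i aperiodic))" by (rule range_inj_infinite)
  moreover have "range (\<lambda>i. shift i aperiodic) \<subseteq> tails"
  proof
    fix x assume "x \<in> range (\<lambda>i. shift i aperiodic)"
    then obtain i where "shift 0 x = shift i aperiodic" by auto
    then show "x \<in> tails" unfolding tails_def by blast
  qed
  ultimately show ?thesis using infinite_super by blast
qed

lemma tails_act:
  assumes "g \<in> V_set" "x \<in> tails"
  shows "g x \<in> tails"
proof -
  obtain N s where "\<And>y. agree N x y \<Longrightarrow> g y = conc s (shift N y)"
    using V_set_locpre[OF assms(1), of x] unfolding locpre_def by blast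
  then have "g x = conc s (shift N x)" by simp
  then have gx: "shift (length s) (g x) = shift N x" by simp
  obtain a b where ab: "shift a x = shift b aperiodic" using assms(2) by (auto simp: tails_def)
  have "shift (length s + a) (g x) = shift (N + a) x"
    using arg_cong[OF gx, of "shift a"] by simp
  also have "\<dots> = shift (b + N) aperiodic"
    using arg_cong[OF ab, of "shift N"] by (simp add: add.commute)
  finally show ?thesis unfolding tails_def by blast
qed

lemma finite_uniform:
  fixes P :: "'a \<Rightarrow> nat \<Rightarrow> bool"
  assumes "finite A" "\<And>a. a \<in> A \<Longrightarrow> \<exists>N. P a N" "\<And>a M N. P a M \<Longrightarrow> M \<le> N \<Longrightarrow> P a N"
  shows "\<exists>N. \<forall>a\<in>A. P a N"
  using assms(1,2)
proof (induction A)
  case (insert a A)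
  then obtain N where N1: "\<forall>a\<in>A. P a N" by auto
  obtain M where "P a M" using insert.prems by blast
  note N = N1 this
  have "P b (max N M)" if "b \<in> insert a A" for b
    using that N assms(3)[of b N "max N M"] assms(3)[of b M "max N M"] by auto
  then show ?case by blast
qed simp

lemma separate:
  assumes "finite T"
  shows "\<exists>N. \<forall>x\<in>T. \<forall>y\<in>T. agree N x y \<longrightarrow> x = y"
proof -
  have "\<exists>N. \<forall>p\<in>T \<times> T. agree N (fst p) (snd p) \<longrightarrow> fst p = snd p"
  proof (rule finite_uniform)
    fix p :: "(nat \<Rightarrow> bool) \<times> (nat \<Rightarrow> bool)"
    show "\<exists>N. agree N (fst p) (snd p) \<longrightarrow> fst p = snd p"
    proof (cases "fst p = snd p")
      case False
      then obtain k where "fst p k \<noteq> snd p k" by (auto simp: fun_eq_iff)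
      then have "\<not> agree (Suc k) (fst p) (snd p)" by (auto simp: agree_def)
      then show ?thesis by blast
    qed simp
  next
    fix p :: "(nat \<Rightarrow> bool) \<times> (nat \<Rightarrow> bool)" and M N
    assume "agree M (fst p) (snd p) \<longrightarrow> fst p = snd p" "M \<le> N"
    then show "agree N (fst p) (snd p) \<longrightarrow> fst p = snd p" using agree_mono by blast
  qed (use assms in simp)
  then show ?thesis by auto
qed

section \<open>High transitivity on the tail class\<close>

definition swap :: "bool list \<Rightarrow> bool list \<Rightarrow> (nat \<Rightarrow> bool) \<Rightarrow> nat \<Rightarrow> bool" where
  "swap r s y = (if y \<in> cylinder r then conc s (shift (length r) y)
     else if y \<in> cylinder s then conc r (shift (length s) y) else y)"

lemma swap_in_V:
  assumes disj: "cylinder r \<inter> cylinder s = {}"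
  shows "swap r s \<in> V_set"
proof (rule V_setI)
  have "swap r s (swap r s y) = y" for y
  proof -
    have "conc s z \<notin> cylinder r" for z using conc_in_cylinder[of s z] disj by blast
    then show ?thesis
      by (auto simp: swap_def conc_in_cylinder) (auto simp: cylinder_iff)
  qed
  then show "bij (swap r s)" by (intro o_bij[of "swap r s"]) (auto simp: fun_eq_iff)
  fix x
  consider "x \<in> cylinder r" | "x \<in> cylinder s" | "x \<notin> cylinder r" "x \<notin> cylinder s" by blast
  then show "locpre (swap r s) x"
  proof cases
    case 1
    show ?thesis
    proof (rule locpreI)
      fix y assume "agree (length r) x y"
      then show "swap r s y = conc s (shift (length r) y)"
        using agree_cylinder[OF 1] by (simp add: swap_def)
    qed
  next
    case 2
    show ?thesis
    proof (rule locpreI)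
      fix y assume "agree (length s) x y"
      then have "y \<in> cylinder s" by (rule agree_cylinder[OF 2])
      moreover from this have "y \<notin> cylinder r" using disj by blast
      ultimately show "swap r s y = conc r (shift (length s) y)" by (simp add: swap_def)
    qed
  next
    case 3
    show ?thesis
    proof (rule locpre_local[OF locpre_id])
      fix y assume y: "agree (max (length r) (length s)) x y"
      have "agree (length r) y x" "agree (length s) y x"
        using agree_mono[OF agree_sym[OF y]] by auto
      then have "y \<notin> cylinder r" "y \<notin> cylinder s"
        using 3 agree_cylinder by blast+
      then show "swap r s y = id y" by (simp add: swap_def)
    qed
  qed
qed

lemma cylinder_pre: "y \<in> cylinder (pre N x) \<longleftrightarrow> agree N x y"
  by (auto simp: cylinder_def pre_def agree_def)

lemma V_move_point:
  assumes "a \<in> tails" "b \<in> tails" "a \<noteq> b" "finite T" "a \<notin> T" "b \<notin> T"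
  shows "\<exists>g\<in>V_set. g a = b \<and> (\<forall>x\<in>T. g x = x)"
proof -
  obtain p q p' q' where pq: "shift p a = shift q aperiodic" "shift p' b = shift q' aperiodic"
    using assms(1,2) by (auto simp: tails_def)
  \<comment> \<open>Shifting further by q' and by q respectively aligns both tails at position q +
    q' of \<open>aperiodic\<close>.\<close>
  define m where "m = p + q'"
  define n where "n = p' + q"
  have mn: "shift (m + L) a = shift (n + L) b" for L
    using arg_cong[OF pq(1), of "shift (q' + L)"] arg_cong[OF pq(2), of "shift (q + L)"]
    by (simp add: m_def n_def add_ac)
  \<comment> \<open>At depth L the points a, b and those of T are told apart, so the two cylinders
    to be exchanged are disjoint and miss T.\<close>
  obtain L where L: "\<And>x y. x \<in> insert a (insert b T) \<Longrightarrow> y \<in> insert a (insert b T) \<Longrightarrow>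
      agree L x y \<Longrightarrow> x = y"
    using separate[of "insert a (insert b T)"] assms(4) by blast
  let ?r = "pre (m + L) a" and ?s = "pre (n + L) b"
  have "cylinder ?r \<inter> cylinder ?s = {}"
  proof (rule ccontr)
    assume "cylinder ?r \<inter> cylinder ?s \<noteq> {}"
    then obtain z where "agree (m + L) a z" "agree (n + L) b z" by (auto simp: cylinder_pre)
    then have "agree L a z" "agree L b z" by (auto elim: agree_mono)
    then have "agree L a b" using agree_trans agree_sym by blast
    then show False using L[of a b] assms(3) by simp
  qed
  then have "swap ?r ?s \<in> V_set" by (rule swap_in_V)
  moreover have "swap ?r ?s a = b"
    using conc_pre_shift[of "n + L" b b] by (simp add: swap_def cylinder_pre mn)
  moreover have "swap ?r ?s x = x" if "x \<in> T" for x
  proof -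
    have "\<not> agree (m + L) a x" "\<not> agree (n + L) b x"
      using L[of a x] L[of b x] that assms(5,6) agree_mono[of _ _ _ L] by auto
    then show ?thesis by (simp add: swap_def cylinder_pre)
  qed
  ultimately show ?thesis by blast
qed

text \<open>Points are placed one at a time, each new move fixing the points that are already in
  place.\<close>

lemma V_transitive:
  "xs \<in> dtup q tails \<Longrightarrow> ys \<in> dtup q tails \<Longrightarrow> \<exists>g\<in>V_set. map g xs = ys"
proof (induction q arbitrary: xs ys)
  case 0
  then show ?case using V.id_mem by (auto simp: dtup_def tup_def)
next
  case (Suc q)
  obtain x xs' where x: "xs = x # xs'" using Suc.prems(1) by (cases xs) (auto simp: dtup_def tup_def)
  obtain y ys' where y: "ys = y # ys'" using Suc.prems(2) by (cases ys) (auto simp: dtup_def tup_def)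
  have "xs' \<in> dtup q tails" "ys' \<in> dtup q tails"
    using Suc.prems by (auto simp: x y dtup_def tup_def)
  then obtain g where g: "g \<in> V_set" "map g xs' = ys'" using Suc.IH by blast
  have gx: "g x \<in> tails" using tails_act[OF g(1)] Suc.prems(1) by (simp add: x dtup_def tup_def)
  have "x \<notin> set xs'" using Suc.prems(1) by (simp add: x dtup_def)
  then have nx: "g x \<notin> set ys'"
    using inj_image_mem_iff[OF bij_is_inj[OF V_set_bij[OF g(1)]], of x "set xs'"] g(2) by auto
  show ?case
  proof (cases "g x = y")
    case True
    then show ?thesis using g x y by auto
  next
    case False
    obtain h where "h \<in> V_set" "h (g x) = y" "\<forall>z\<in>set ys'. h z = z"
      using V_move_point[OF gx _ False finite_set nx] Suc.prems(2) by (auto simp: y dtup_def tup_def)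
    then show ?thesis
      using g x y V.comp_mem by (intro bexI[of _ "h \<circ> g"]) (auto simp flip: map_map intro: map_idI)
  qed
qed

section \<open>Stabilizers and their disjoint blocks\<close>

text \<open>If replacing N symbols by s fixes x, then x has equal shifts by N and by
  \<open>length s\<close>. By aperiodicity the lengths agree, and then s is the old prefix of
  x.\<close>

lemma V_stabilizer_local:
  assumes "g \<in> V_set" "x \<in> tails" "g x = x"
  shows "\<exists>N. \<forall>y. agree N x y \<longrightarrow> g y = y"
proof -
  obtain N s where s: "\<And>y. agree N x y \<Longrightarrow> g y = conc s (shift N y)"
    using V_set_locpre[OF assms(1), of x] unfolding locpre_def by blast
  have x: "x = conc s (shift N x)" using s[of x] assms(3) by simp
  then have "shift (length s) x = shift N x" by (metis shift_conc)
  then have len: "length s = N" by (rule tails_aperiodic[OF assms(2)])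
  have "g y = y" if "agree N x y" for y
    using conc_of_agree[of s "shift N x" y] s[OF that] that x len by metis
  then show ?thesis by blast
qed

text \<open>The complement \<open>A\<close> of small neighbourhoods of the points of \<open>P\<close> has infinitely many disjoint
  copies: \<open>A\<close> itself and the sets \<open>conc (u i) ` A\<close>, \<open>i \<ge> 1\<close>, inside the neighbourhood of \<open>x\<^sub>0\<close>.\<close>

locale blocks =
  fixes P :: "(nat \<Rightarrow> bool) set" and x\<^sub>0 :: "nat \<Rightarrow> bool" and N M :: nat
  assumes x0: "x\<^sub>0 \<in> P" and sep: "x \<in> P \<Longrightarrow> agree N x\<^sub>0 x \<Longrightarrow> x = x\<^sub>0"
begin

definition A :: "(nat \<Rightarrow> bool) set" where
  "A = {y. \<forall>x\<in>P. \<not> agree N x y}"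

text \<open>The first N symbols put the copy near \<open>x\<^sub>0\<close>, the flipped bit keeps it
  away from \<open>x\<^sub>0\<close> itself, and the code 1...10 makes the words with positive index
  pairwise incompatible. The empty word keeps A as block 0.\<close>

definition u :: "nat \<Rightarrow> bool list" where
  "u i = (if i = 0 then [] else pre N x\<^sub>0 @ [\<not> x\<^sub>0 N] @ replicate i True @ [False])"

definition D :: "(nat \<Rightarrow> bool) set" where
  "D = {conc (u i) a |i a. i \<le> M \<and> a \<in> A}"

definition H :: "((nat \<Rightarrow> bool) \<Rightarrow> nat \<Rightarrow> bool) set" where
  "H = {h \<in> V_set. \<forall>y. y \<notin> A \<longrightarrow> h y = y}"

text \<open>\<open>SOME\<close> recovers the block and the point inside it, which are unique by
  \<open>u_inj\<close>.\<close>

definition \<beta> :: "(nat \<Rightarrow> nat) \<Rightarrow> (nat \<Rightarrow> (nat \<Rightarrow> bool) \<Rightarrow> nat \<Rightarrow> bool) \<Rightarrow> (nat \<Rightarrow> bool) \<Rightarrow> nat \<Rightarrow> bool" where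
  "\<beta> \<sigma> c y = (if y \<in> D
     then let p = SOME p. fst p \<le> M \<and> snd p \<in> A \<and> y = conc (u (fst p)) (snd p)
          in conc (u (\<sigma> (fst p))) (c (fst p) (snd p))
     else y)"

lemma A_agree: "a \<in> A \<Longrightarrow> agree N a b \<Longrightarrow> b \<in> A"
  unfolding A_def using agree_trans agree_sym by blast

lemma u_outside: "i \<ge> 1 \<Longrightarrow> conc (u i) a \<notin> A"
proof -
  assume "i \<ge> 1"
  then have "agree N x\<^sub>0 (conc (u i) a)"
    by (auto simp: agree_def conc_def u_def pre_def nth_append)
  then show ?thesis using x0 by (auto simp: A_def)
qed

lemma u_avoids: "i \<ge> 1 \<Longrightarrow> x \<in> P \<Longrightarrow> conc (u i) a \<noteq> x"
proof
  assume i: "i \<ge> 1" and x: "x \<in> P" and eq: "conc (u i) a = x"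
  have "agree N x\<^sub>0 x" using i
    by (auto simp: agree_def conc_def u_def pre_def nth_append eq[symmetric])
  then have "x = x\<^sub>0" using sep x by blast
  moreover have "conc (u i) a N = (\<not> x\<^sub>0 N)" using i
    by (simp add: conc_def u_def pre_def nth_append)
  ultimately show False using eq by auto
qed

text \<open>Position N + 1 + i carries the closing 0 of word i, but still a 1 of word j.\<close>

lemma u_less: "1 \<le> i \<Longrightarrow> i < j \<Longrightarrow> conc (u i) a \<noteq> conc (u j) b"
proof
  assume ij: "1 \<le> i" "i < j" and eq: "conc (u i) a = conc (u j) b"
  have "\<not> conc (u i) a (N + 1 + i)" using ij
    by (simp add: conc_def u_def nth_append nth_Cons')
  moreover have "conc (u j) b (N + 1 + i)" using ij
    by (simp add: conc_def u_def nth_append nth_Cons')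
  ultimately show False using eq by simp
qed

text \<open>The empty word \<open>u 0\<close> is a prefix of all the others, so block 0 is separated
  from them by a different reason: A misses the neighbourhood of \<open>x\<^sub>0\<close> that
  contains the other copies.\<close>

lemma u_inj:
  assumes "a \<in> A" "b \<in> A" "conc (u i) a = conc (u j) b"
  shows "i = j \<and> a = b"
proof -
  have "i = j"
  proof (rule ccontr)
    assume "i \<noteq> j"
    then consider "i = 0" "j \<ge> 1" | "j = 0" "i \<ge> 1" | "1 \<le> i" "i < j" | "1 \<le> j" "j < i" by linarith
    then show False
    proof cases
      case 1 then show ?thesis using assms u_outside[of j b] by (simp add: u_def[of 0])
    next
      case 2 then show ?thesis using assms u_outside[of i a] by (simp add: u_def[of 0])
    next
      case 3 then show ?thesis using assms(3) u_less by blast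
    next
      case 4 then show ?thesis using assms(3) u_less by metis
    qed
  qed
  then show ?thesis using assms(3) by (simp add: inj_conc)
qed

lemma \<beta>_block:
  assumes "i \<le> M" "a \<in> A"
  shows "\<beta> \<sigma> c (conc (u i) a) = conc (u (\<sigma> i)) (c i a)"
proof -
  have "(SOME p. fst p \<le> M \<and> snd p \<in> A \<and> conc (u i) a = conc (u (fst p)) (snd p)) = (i, a)"
  proof (rule some_equality)
    fix p assume "fst p \<le> M \<and> snd p \<in> A \<and> conc (u i) a = conc (u (fst p)) (snd p)"
    then show "p = (i, a)" using u_inj[of a "snd p" i "fst p"] assms by (cases p) auto
  qed (use assms in simp)
  moreover have "conc (u i) a \<in> D" using assms by (auto simp: D_def)
  ultimately show ?thesis by (simp add: \<beta>_def)
qed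

lemma \<beta>_outside: "y \<notin> D \<Longrightarrow> \<beta> \<sigma> c y = y"
  by (simp add: \<beta>_def)

lemma H_V: "h \<in> H \<Longrightarrow> h \<in> V_set"
  by (simp add: H_def)

lemma H_A:
  assumes "h \<in> H" "a \<in> A"
  shows "h a \<in> A"
proof (rule ccontr)
  assume "h a \<notin> A"
  then have "h (h a) = h a" using assms(1) by (simp add: H_def)
  then have "h a = a" using bij_is_inj[OF V_set_bij[OF H_V[OF assms(1)]]] by (simp add: inj_eq)
  then show False using \<open>h a \<notin> A\<close> assms(2) by simp
qed

lemma H_inv: "h \<in> H \<Longrightarrow> finv h \<in> H"
  using V.inv_mem bij_is_inj[OF V_set_bij] by (auto simp: H_def intro: inv_f_eq)

lemma \<beta>_comp:
  assumes "\<tau> permutes {..M}" and "\<And>i. d i \<in> H"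
  shows "\<beta> \<sigma> c \<circ> \<beta> \<tau> d = \<beta> (\<sigma> \<circ> \<tau>) (\<lambda>i. c (\<tau> i) \<circ> d i)"
proof
  fix y
  show "(\<beta> \<sigma> c \<circ> \<beta> \<tau> d) y = \<beta> (\<sigma> \<circ> \<tau>) (\<lambda>i. c (\<tau> i) \<circ> d i) y"
  proof (cases "y \<in> D")
    case True
    then obtain i a where ia: "i \<le> M" "a \<in> A" "y = conc (u i) a" by (auto simp: D_def)
    have "\<tau> i \<le> M" using permutes_in_image[OF assms(1), of i] ia(1) by simp
    then show ?thesis using \<beta>_block H_A[OF assms(2) ia(2)] ia by simp
  qed (simp add: \<beta>_outside)
qed

lemma \<beta>_id: "\<beta> id (\<lambda>_. id) = id"
proof
  fix y show "\<beta> id (\<lambda>_. id) y = id y"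
    using \<beta>_block[of _ _ id "\<lambda>_. id"] by (cases "y \<in> D") (auto simp: D_def \<beta>_outside)
qed

lemma \<beta>_V:
  assumes \<sigma>: "\<sigma> permutes {..M}" and c: "\<And>i. c i \<in> H"
  shows "\<beta> \<sigma> c \<in> V_set"
proof (rule V_setI)
  \<comment> \<open>The inverse in the wreath product: block i undoes what was applied on the block
    that \<sigma> sends to i.\<close>
  let ?c = "\<lambda>i. finv (c (finv \<sigma> i))"
  have "\<beta> (finv \<sigma>) ?c \<circ> \<beta> \<sigma> c = id" "\<beta> \<sigma> c \<circ> \<beta> (finv \<sigma>) ?c = id"
    using permutes_inverses[OF \<sigma>] permutes_inv_o[OF \<sigma>] V.comp_inv[OF H_V[OF c]]
    by (simp_all add: \<beta>_comp[OF \<sigma> c] \<beta>_comp[OF permutes_inv[OF \<sigma>] H_inv[OF c]] \<beta>_id)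
  then show "bij (\<beta> \<sigma> c)" by (rule o_bij)
  fix y
  show "locpre (\<beta> \<sigma> c) y"
  proof (cases "y \<in> D")
    case True
    then obtain i a where ia: "i \<le> M" "a \<in> A" "y = conc (u i) a" by (auto simp: D_def)
    have "locpre (conc (u (\<sigma> i)) \<circ> (c i \<circ> shift (length (u i)))) y"
      by (intro locpre_comp locpre_conc locpre_shift V_set_locpre[OF H_V[OF c]])
    then show ?thesis
    proof (rule locpre_local)
      fix z assume z: "agree (length (u i) + N) y z"
      let ?b = "shift (length (u i)) z"
      have zb: "z = conc (u i) ?b"
        using conc_of_agree[of "u i" a z] agree_mono[OF z] ia(3) by simp
      have "agree N (shift (length (u i)) y) ?b" using z by (simp add: agree_def shift_def)
      then have "?b \<in> A" using A_agree[OF ia(2)] ia(3) by simp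
      then show "\<beta> \<sigma> c z = (conc (u (\<sigma> i)) \<circ> (c i \<circ> shift (length (u i)))) z"
        using \<beta>_block[OF ia(1), of ?b \<sigma> c] zb by simp
    qed
  next
    case False
    show ?thesis
    proof (rule locpre_local[OF locpre_id])
      \<comment> \<open>The longest word \<open>u M\<close> has length N + M + 2, and N further
        symbols decide membership in A.\<close>
      fix z assume z: "agree (N + M + 2 + N) y z"
      have "z \<notin> D"
      proof
        assume "z \<in> D"
        then obtain i a where ia: "i \<le> M" "a \<in> A" "z = conc (u i) a" by (auto simp: D_def)
        have len: "length (u i) + N \<le> N + M + 2 + N" using ia(1) by (simp add: u_def)
        have zy: "agree (length (u i) + N) z y" by (rule agree_mono[OF agree_sym[OF z] len])
        have y: "conc (u i) (shift (length (u i)) y) = y"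
          using conc_of_agree[of "u i" a y] agree_mono[OF zy] ia(3) by simp
        have "agree N (shift (length (u i)) z) (shift (length (u i)) y)"
          using zy by (simp add: agree_def shift_def)
        then have "shift (length (u i)) y \<in> A" using A_agree[OF ia(2)] ia(3) by simp
        then show False using False y ia(1) unfolding D_def by (metis (mono_tags, lifting) mem_Collect_eq)
      qed
      then show "\<beta> \<sigma> c z = id z" by (simp add: \<beta>_outside)
    qed
  qed
qed

lemma \<beta>_fixes: "x \<in> P \<Longrightarrow> \<beta> \<sigma> c x = x"
proof (rule \<beta>_outside)
  assume x: "x \<in> P"
  then have "x \<notin> A" unfolding A_def using agree_refl by blast
  show "x \<notin> D"
  proof
    assume "x \<in> D"
    then obtain i a where ia: "a \<in> A" "x = conc (u i) a" by (auto simp: D_def)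
    then show False using \<open>x \<notin> A\<close> u_avoids[of i x a] x by (cases "i = 0") (auto simp: u_def)
  qed
qed

lemma \<beta>_base:
  assumes "h \<in> H"
  shows "\<beta> id ((\<lambda>_. id)(0 := h)) = h"
proof
  fix y
  show "\<beta> id ((\<lambda>_. id)(0 := h)) y = h y"
  proof (cases "y \<in> D")
    case True
    then obtain i a where ia: "i \<le> M" "a \<in> A" "y = conc (u i) a" by (auto simp: D_def)
    show ?thesis
    proof (cases "i = 0")
      case True
      then show ?thesis using \<beta>_block[OF ia(1,2)] ia(3) by (simp add: u_def)
    next
      case False
      then have "y \<notin> A" using u_outside ia(3) by simp
      then show ?thesis using False \<beta>_block[OF ia(1,2)] ia(3) assms by (simp add: H_def)
    qed
  next
    case False
    have "y \<notin> A"
    proof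
      assume "y \<in> A"
      then have "conc (u 0) y \<in> D" unfolding D_def by blast
      then show False using False by (simp add: u_def)
    qed
    then show ?thesis using False assms by (simp add: \<beta>_outside H_def)
  qed
qed

end

lemma V_stabilizer_displaceable:
  assumes xs: "xs \<in> dtup (Suc q) tails"
  shows "displaceable {g \<in> V_set. \<forall>x\<in>set xs. g x = x}"
  unfolding displaceable_def
proof (intro allI impI)
  fix S M assume S: "finite S \<and> S \<subseteq> {g \<in> V_set. \<forall>x\<in>set xs. g x = x}"
  obtain x\<^sub>0 where x0: "x\<^sub>0 \<in> set xs" using xs by (cases xs) (auto simp: dtup_def tup_def)
  obtain N1 where N1: "\<forall>x\<in>set xs. \<forall>y\<in>set xs. agree N1 x y \<longrightarrow> x = y"
    using separate[OF finite_set] by blast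
  have "\<exists>N. \<forall>p\<in>S \<times> set xs. \<forall>y. agree N (snd p) y \<longrightarrow> fst p y = y"
  proof (rule finite_uniform)
    fix p assume p: "p \<in> S \<times> set xs"
    then have "snd p \<in> tails" using xs by (auto simp: dtup_def tup_def)
    then show "\<exists>N. \<forall>y. agree N (snd p) y \<longrightarrow> fst p y = y"
      using p S by (intro V_stabilizer_local) auto
  next
    fix p :: "((nat \<Rightarrow> bool) \<Rightarrow> nat \<Rightarrow> bool) \<times> (nat \<Rightarrow> bool)" and M N
    assume "\<forall>y. agree M (snd p) y \<longrightarrow> fst p y = y" "M \<le> N"
    then show "\<forall>y. agree N (snd p) y \<longrightarrow> fst p y = y" using agree_mono by blast
  qed (use S in simp)
  then obtain N2 where N2: "\<forall>p\<in>S \<times> set xs. \<forall>y. agree N2 (snd p) y \<longrightarrow> fst p y = y" by blast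
  \<comment> \<open>N1 separates the fixed points, and at depth N2 every element of the finite set S
    is the identity near them. Finiteness of S is what provides a single depth.\<close>
  define N where "N = max N1 N2"
  interpret blocks "set xs" x\<^sub>0 N M
  proof
    fix x assume x: "x \<in> set xs" "agree N x\<^sub>0 x"
    have "agree N1 x\<^sub>0 x" using agree_mono[OF x(2)] by (simp add: N_def)
    then show "x = x\<^sub>0" using N1 x0 x(1) by blast
  qed (rule x0)
  have SH: "insert id S \<subseteq> H"
  proof -
    have "h y = y" if "h \<in> S" "y \<notin> A" for h y
    proof -
      obtain x where x: "x \<in> set xs" "agree N x y" using \<open>y \<notin> A\<close> by (auto simp: A_def)
      then have "agree N2 x y" using agree_mono[OF x(2)] by (simp add: N_def)
      then show ?thesis using N2 \<open>h \<in> S\<close> x(1) by auto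
    qed
    then show ?thesis using S V.id_mem by (auto simp: H_def)
  qed
  show "\<exists>\<beta>. (\<forall>\<sigma> c. \<sigma> permutes {..M} \<and> range c \<subseteq> insert id S \<longrightarrow>
              \<beta> \<sigma> c \<in> {g \<in> V_set. \<forall>x\<in>set xs. g x = x}) \<and>
            (\<forall>\<sigma> \<tau> c d. \<sigma> permutes {..M} \<and> \<tau> permutes {..M} \<and>
              range c \<subseteq> insert id S \<and> range d \<subseteq> insert id S \<longrightarrow>
              \<beta> \<sigma> c \<circ> \<beta> \<tau> d = \<beta> (\<sigma> \<circ> \<tau>) (\<lambda>i. c (\<tau> i) \<circ> d i)) \<and>
            (\<forall>h\<in>S. \<beta> id ((\<lambda>_. id)(0 := h)) = h)"
  proof (intro exI[of _ \<beta>] conjI allI impI ballI)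
    fix \<sigma> and c :: "nat \<Rightarrow> (nat \<Rightarrow> bool) \<Rightarrow> nat \<Rightarrow> bool"
    assume "\<sigma> permutes {..M} \<and> range c \<subseteq> insert id S"
    then show "\<beta> \<sigma> c \<in> {g \<in> V_set. \<forall>x\<in>set xs. g x = x}"
      using SH \<beta>_V[of \<sigma> c] \<beta>_fixes by blast
  next
    fix \<sigma> \<tau> and c d :: "nat \<Rightarrow> (nat \<Rightarrow> bool) \<Rightarrow> nat \<Rightarrow> bool"
    assume "\<sigma> permutes {..M} \<and> \<tau> permutes {..M} \<and>
      range c \<subseteq> insert id S \<and> range d \<subseteq> insert id S"
    then show "\<beta> \<sigma> c \<circ> \<beta> \<tau> d = \<beta> (\<sigma> \<circ> \<tau>) (\<lambda>i. c (\<tau> i) \<circ> d i)"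
      using SH by (intro \<beta>_comp) blast+
  next
    fix h assume "h \<in> S"
    then show "\<beta> id ((\<lambda>_. id)(0 := h)) = h" using SH by (intro \<beta>_base) blast
  qed
qed

interpretation V: highly_transitive V_set tails
proof
  show "infinite tails" by (rule infinite_tails)
qed (auto intro: tails_act V_transitive V_stabilizer_displaceable)

section \<open>Bounded cohomology of V\<close>

lemma thompson_V_simps [simp]:
  "mult thompson_V = (\<circ>)" "\<one>\<^bsub>thompson_V\<^esub> = id"
  by (simp_all add: thompson_V_def Homeo_def)

lemma group_thompson_V: "group thompson_V"
proof (rule groupI)
  fix g assume "g \<in> carrier thompson_V"
  then show "\<exists>h\<in>carrier thompson_V. h \<otimes>\<^bsub>thompson_V\<^esub> g = \<one>\<^bsub>thompson_V\<^esub>"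
    using V.inv_mem V.comp_inv(2) by (intro bexI[of _ "finv g"]) (auto simp: carrier_thompson_V)
qed (auto simp: carrier_thompson_V V.id_mem V.comp_mem comp_assoc)

lemma m_inv_thompson_V: "g \<in> V_set \<Longrightarrow> m_inv thompson_V g = finv g"
  using group.inv_equality[OF group_thompson_V, of "finv g" g] V.inv_mem V.comp_inv(2)
  by (simp add: carrier_thompson_V)

lemma tuples_thompson_V: "tuples thompson_V n = tup (Suc n) V_set"
  by (simp add: tuples_def tup_def carrier_thompson_V)

text \<open>The action translates by inverses, but invariance under all inverses is invariance under
  all elements of the group.\<close>

lemma invariant_bounded_cochains_thompson_V:
  "f \<in> invariant_bounded_cochains thompson_V n \<longleftrightarrow>
     f \<in> extensional (tup (Suc n) V_set) \<and> inv_cochain V_set V_set (Suc n) f"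
proof -
  define Q where "Q g \<longleftrightarrow> (\<forall>gs\<in>tup (Suc n) V_set. f (map ((\<circ>) g) gs) = f gs)" for g
  have "cochain_act thompson_V n g f = f \<longleftrightarrow> Q (finv g)"
    if "g \<in> V_set" "f \<in> extensional (tup (Suc n) V_set)" for g
    using that unfolding cochain_act_def tuples_thompson_V Q_def
    by (auto simp: m_inv_thompson_V fun_eq_iff restrict_def extensional_def)
  moreover have "(\<forall>g\<in>V_set. Q (finv g)) \<longleftrightarrow> (\<forall>g\<in>V_set. Q g)"
    using V.inv_mem V.bij_mem by (metis inv_inv_eq)
  ultimately have "(\<forall>g\<in>V_set. cochain_act thompson_V n g f = f) \<longleftrightarrow> (\<forall>g\<in>V_set. Q g)"
    if "f \<in> extensional (tup (Suc n) V_set)"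
    using that by simp
  then show ?thesis
    unfolding Q_def
    by (auto simp: invariant_bounded_cochains_def bounded_cochains_def inv_cochain_def
        tuples_thompson_V carrier_thompson_V bounded_iff)
qed

lemma coboundary_thompson_V:
  "coboundary thompson_V n f = (\<lambda>gs\<in>tup (Suc (Suc n)) V_set. cob f gs)"
  unfolding coboundary_def tuples_thompson_V
  by (rule restrict_ext) (simp add: cob_def tup_def lessThan_Suc_atMost)

lemma bounded_cocycles_thompson_V:
  "f \<in> bounded_cocycles thompson_V n \<longleftrightarrow>
     f \<in> extensional (tup (Suc n) V_set) \<and> inv_cochain V_set V_set (Suc n) f \<and>
     (\<forall>gs\<in>tup (Suc (Suc n)) V_set. cob f gs = 0)"
  by (auto simp: bounded_cocycles_def kernel_def cochain_group_def coboundary_thompson_V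
      tuples_thompson_V invariant_bounded_cochains_thompson_V restrict_def fun_eq_iff)

lemma bounded_coboundaries_eq_cocycles:
  assumes "n \<ge> 1"
  shows "bounded_coboundaries thompson_V n = bounded_cocycles thompson_V n"
proof -
  obtain m where m: "n = Suc m" using assms by (cases n) auto
  have "f \<in> bounded_coboundaries thompson_V n" if f: "f \<in> bounded_cocycles thompson_V n" for f
  proof -
    from f have ext: "f \<in> extensional (tup (Suc n) V_set)" and inv: "inv_cochain V_set V_set (Suc n) f"
      and closed: "\<forall>gs\<in>tup (Suc (Suc n)) V_set. cob f gs = 0"
      by (auto simp: bounded_cocycles_thompson_V)
    obtain e where e: "inv_cochain V_set V_set n e" "\<forall>gs\<in>tup (Suc n) V_set. cob e gs = f gs"
      using V.cocycle_exact[OF inv assms closed] by blast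
    \<comment> \<open>The primitive is arbitrary off the tuples; restricting it gives the
      extensional representative without changing any face of a tuple in V.\<close>
    let ?e = "restrict e (tup n V_set)"
    have "inv_cochain V_set V_set n ?e"
      using inv_cochain_cong[OF V.perm_group_axioms order_refl, of n e ?e] e(1) by simp
    then have "?e \<in> invariant_bounded_cochains thompson_V m"
      by (simp add: invariant_bounded_cochains_thompson_V m)
    moreover have "coboundary thompson_V m ?e = f"
    proof
      fix gs
      show "coboundary thompson_V m ?e gs = f gs"
      proof (cases "gs \<in> tup (Suc n) V_set")
        case True
        have "cob ?e gs = cob e gs"
          using omit_tup[OF True] True by (intro cob_cong) (simp add: tup_def)
        then show ?thesis using True e(2) by (simp add: coboundary_thompson_V m)
      next
        case False
        then show ?thesis using ext by (simp add: coboundary_thompson_V m extensional_def)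
      qed
    qed
    ultimately show ?thesis by (auto simp: m cochain_group_def)
  qed
  moreover have "f \<in> bounded_cocycles thompson_V n" if f: "f \<in> bounded_coboundaries thompson_V n" for f
  proof -
    obtain e where e: "e \<in> invariant_bounded_cochains thompson_V m" "f = coboundary thompson_V m e"
      using f by (auto simp: m cochain_group_def)
    have fe: "f gs = cob e gs" if "gs \<in> tup (Suc n) V_set" for gs
      using that by (simp add: e(2) coboundary_thompson_V m)
    have "inv_cochain V_set V_set (Suc n) (cob e)"
      using e(1) by (intro inv_cochain_cob) (simp add: invariant_bounded_cochains_thompson_V m)
    then have "inv_cochain V_set V_set (Suc n) f"
      using inv_cochain_cong[OF V.perm_group_axioms order_refl, of "Suc n" f "cob e"] fe by simp
    moreover have "cob f gs = 0" if "gs \<in> tup (Suc (Suc n)) V_set" for gs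
    proof -
      have "cob f gs = cob (cob e) gs"
        using omit_tup[OF that] that fe by (intro cob_cong) (simp add: tup_def)
      then show ?thesis by (simp add: cob_cob)
    qed
    ultimately show ?thesis
      by (simp add: bounded_cocycles_thompson_V e(2) coboundary_thompson_V m)
  qed
  ultimately show ?thesis by blast
qed

lemma restrict_cocycle:
  assumes "inv_cochain V_set V_set (Suc n) f"
    and "\<And>gs. gs \<in> tup (Suc (Suc n)) V_set \<Longrightarrow> cob f gs = 0"
  shows "restrict f (tup (Suc n) V_set) \<in> bounded_cocycles thompson_V n"
proof -
  let ?f = "restrict f (tup (Suc n) V_set)"
  have "inv_cochain V_set V_set (Suc n) ?f"
    using inv_cochain_cong[OF V.perm_group_axioms order_refl, of "Suc n" f ?f] assms(1) by simp
  moreover have "cob ?f gs = 0" if "gs \<in> tup (Suc (Suc n)) V_set" for gs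
  proof -
    have "cob ?f gs = cob f gs"
      using omit_tup[OF that] that by (intro cob_cong) (simp add: tup_def)
    then show ?thesis using assms(2)[OF that] by simp
  qed
  ultimately show ?thesis by (simp add: bounded_cocycles_thompson_V)
qed

text \<open>Outside the tuples both sides of each group law are \<open>undefined\<close>, so the
  laws hold as equalities of functions.\<close>

lemma group_bounded_cocycles:
  "group (cochain_group thompson_V n\<lparr>carrier := bounded_cocycles thompson_V n\<rparr>)" (is "group ?Z")
proof (rule groupI)
  let ?T = "tup (Suc n) V_set"
  have carr: "carrier ?Z = bounded_cocycles thompson_V n" by simp
  have mult: "f \<otimes>\<^bsub>?Z\<^esub> h = restrict (\<lambda>gs. f gs + h gs) ?T" for f h
    by (simp add: cochain_group_def tuples_thompson_V)
  have one: "\<one>\<^bsub>?Z\<^esub> = restrict (\<lambda>_. 0) ?T"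
    by (simp add: cochain_group_def tuples_thompson_V)
  have ext: "f gs = undefined" if "f \<in> carrier ?Z" "gs \<notin> ?T" for f gs
    using that by (simp add: bounded_cocycles_thompson_V extensional_def)
  show "f \<otimes>\<^bsub>?Z\<^esub> h \<in> carrier ?Z" if "f \<in> carrier ?Z" "h \<in> carrier ?Z" for f h
    unfolding mult carr using that
    by (intro restrict_cocycle inv_cochain_add) (simp_all add: bounded_cocycles_thompson_V cob_add)
  show "\<one>\<^bsub>?Z\<^esub> \<in> carrier ?Z"
    unfolding one carr by (intro restrict_cocycle) (auto simp: inv_cochain_def cob_def)
  show "f \<otimes>\<^bsub>?Z\<^esub> h \<otimes>\<^bsub>?Z\<^esub> k = f \<otimes>\<^bsub>?Z\<^esub> (h \<otimes>\<^bsub>?Z\<^esub> k)" for f h k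
    unfolding mult by (rule restrict_ext) simp
  show "\<one>\<^bsub>?Z\<^esub> \<otimes>\<^bsub>?Z\<^esub> f = f" if "f \<in> carrier ?Z" for f
    unfolding mult one using ext[OF that] by (auto simp: restrict_def)
  show "\<exists>h\<in>carrier ?Z. h \<otimes>\<^bsub>?Z\<^esub> f = \<one>\<^bsub>?Z\<^esub>" if f: "f \<in> carrier ?Z" for f
  proof
    show "restrict (\<lambda>gs. - f gs) ?T \<in> carrier ?Z"
      unfolding carr using f
      by (intro restrict_cocycle)
        (auto simp: bounded_cocycles_thompson_V inv_cochain_def cob_def sum_negf)
    show "restrict (\<lambda>gs. - f gs) ?T \<otimes>\<^bsub>?Z\<^esub> f = \<one>\<^bsub>?Z\<^esub>"
      unfolding mult one by (rule restrict_ext) simp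
  qed
qed

theorem theorem1p16:
  shows "boundedly_acyclic thompson_V"
  unfolding boundedly_acyclic_def
proof (intro allI impI)
  fix n :: nat assume n: "n \<ge> 1"
  let ?Z = "cochain_group thompson_V n\<lparr>carrier := bounded_cocycles thompson_V n\<rparr>"
  interpret Z: group ?Z by (rule group_bounded_cocycles)
  have eq: "bounded_cohomology thompson_V n = ?Z Mod carrier ?Z"
    by (simp add: bounded_cohomology_def bounded_coboundaries_eq_cocycles[OF n])
  have "carrier (?Z Mod carrier ?Z) = {carrier ?Z}"
  proof -
    have "carrier ?Z #>\<^bsub>?Z\<^esub> f = carrier ?Z" if "f \<in> carrier ?Z" for f
      by (rule Z.coset_join2[OF that Z.subgroup_self that])
    then show ?thesis using Z.one_closed unfolding FactGroup_def RCOSETS_def by auto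
  qed
  moreover have "\<one>\<^bsub>?Z Mod carrier ?Z\<^esub> = carrier ?Z" by (simp add: FactGroup_def)
  ultimately show "trivial_group (bounded_cohomology thompson_V n)"
    unfolding eq trivial_group_def using normal.factorgroup_is_group[OF Z.normal_self] by simp
qed

end
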